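(* Let $A$ be a pro-$C^{*}$-algebra and let $E$ be a Hilbert $A$-module. If the Hilbert $b(A)$-module $b(E)$ admits a standard frame of multipliers, then $E$ admits a standard frame of multipliers.
   Context: A pro-$C^{*}$-algebra $A$ is a complete Hausdorff topological $*$-algebra over $\mathbb{C}$ whose topology is given by a directed family of $C^{*}$-seminorms; $S(A)$ is the directed set of all continuous $C^{*}$-seminorms on $A$ (no unit is assumed). A pre-Hilbert $A$-module is a complex vector space $E$ that is a right $A$-module (compatibly with the complex algebra structure) with an $A$-valued inner product $\langle\cdot,\cdot\rangle_E$, $\mathbb{C}$- and $A$-linear in the second variable, with $\langle\xi,\eta\rangle_E^{*}=\langle\eta,\xi\rangle_E$, $\langle\xi,\xi\rangle_E\ge 0$, and $\langle\xi,\xi\rangle_E=0$ iff $\xi=0$. It is a Hilbert $A$-module if it is complete for the topology given by the seminorms $\overline{p}_E(\xi)=\sqrt{p(\langle\xi,\xi\rangle_E)}$, $p\in S(A)$. $A$ itself is a Hilbert $A$-module with $\langle a,b\rangle_A=a^{*}b$. $b(A)=\{a\in A:\|a\|_\infty=\sup_{p\in S(A)}p(a)<\infty\}$ is a $C^{*}$-algebra in the norm $\|\cdot\|_\infty$, dense in $A$. $b(E)=\{\xi\in E:\|\xi\|_\infty=\sup_{p\in S(A)}\overline{p}_E(\xi)<\infty\}$ is a Hilbert $b(A)$-module (with the restricted operations and inner product), dense in $E$. The definitions below apply to $b(E)$ over the $C^{*}$-algebra $b(A)$ (a $C^{*}$-algebra being a pro-$C^{*}$-algebra with its norm topology) as well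 as to $E$ over $A$; in the case of $b(E)$, multipliers are elements of $M(b(E))=L(b(A),b(E))$ and convergence is in the norm $\|\cdot\|_\infty$ of $b(A)$. $L(E,F)$ denotes the set of adjointable module morphisms $T:E\to F$ between Hilbert $A$-modules (those having a module morphism $T^{*}:F\to E$ with $\langle T\xi,\eta\rangle_F=\langle\xi,T^{*}\eta\rangle_E$). The multiplier module of $E$ is $M(E)=L(A,E)$, a Hilbert module over $M(A)=L(A,A)$ with action $T\cdot S=T\circ S$ and inner product $\langle T,R\rangle_{M(E)}=T^{*}\circ R$. $E$ is identified with a submodule of $M(E)$ through $\xi\mapsto(a\mapsto \xi a)$. For $h\in M(E)$, $\xi\in E$: $\langle h,\xi\rangle_{M(E)}=h^{*}(\xi)\in A$ and $\langle\xi,h\rangle_{M(E)}=h^{*}(\xi)^{*}$. A sequence $\{h_n\}_n$ in $M(E)$ is a standard frame of multipliers in $E$ if for each $\xi\in E$ the series $\sum_n\langle\xi,h_n\rangle_{M(E)}\langle h_n,\xi\rangle_{M(E)}$ converges in $A$ and there are positive constants $C,D$ with $C\langle\xi,\xi\rangle_E\le\sum_n\langle\xi,h_n\rangle_{M(E)}\langle h_n,\xi\rangle_{M(E)}\le D\langle\xi,\xi\rangle_E$ for all $\xi\in E$. *)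

theory Defs
  imports "HOL-Analysis.Analysis"
begin

section \<open>Complex vector spaces and complex *-algebras (no unit assumed)\<close>

class complex_vector = ab_group_add +
  fixes scaleC :: "complex \<Rightarrow> 'a \<Rightarrow> 'a"  (infixr \<open>*\<^sub>C\<close> 75)
  assumes scaleC_add_right: "c *\<^sub>C (x + y) = c *\<^sub>C x + c *\<^sub>C y"
    and scaleC_add_left: "(c + d) *\<^sub>C x = c *\<^sub>C x + d *\<^sub>C x"
    and scaleC_scaleC: "c *\<^sub>C d *\<^sub>C x = (c * d) *\<^sub>C x"
    and scaleC_one: "1 *\<^sub>C x = x"

class star_algebra = ring + complex_vector +
  fixes star :: "'a \<Rightarrow> 'a"
  assumes scaleC_mult_left: "(c *\<^sub>C a) * b = c *\<^sub>C (a * b)"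
    and scaleC_mult_right: "a * (c *\<^sub>C b) = c *\<^sub>C (a * b)"
    and star_star: "star (star a) = a"
    and star_add: "star (a + b) = star a + star b"
    and star_mult: "star (a * b) = star b * star a"
    and star_scaleC: "star (c *\<^sub>C a) = cnj c *\<^sub>C star a"

text \<open>
  The types only supply the algebraic operations.  All analytic structure lives on subsets of
  them, so that an algebra \<open>A\<close> and its subalgebra \<open>b(A)\<close> (with a different topology) are
  instances of the same notions.
\<close>

definition complex_subspace :: "'a::complex_vector set \<Rightarrow> bool" where
  "complex_subspace V \<longleftrightarrow>
     0 \<in> V \<and> (\<forall>x\<in>V. \<forall>y\<in>V. x + y \<in> V) \<and> (\<forall>c. \<forall>x\<in>V. c *\<^sub>C x \<in> V)"

definition star_subalgebra :: "'a::star_algebra set \<Rightarrow> bool" where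
  "star_subalgebra B \<longleftrightarrow>
     complex_subspace B \<and> (\<forall>a\<in>B. \<forall>b\<in>B. a * b \<in> B) \<and> (\<forall>a\<in>B. star a \<in> B)"


section \<open>Topologies given by seminorms, completeness, series\<close>

definition seminorm_topology ::
    "'a::complex_vector set \<Rightarrow> ('a \<Rightarrow> real) set \<Rightarrow> 'a topology" where
  "seminorm_topology V P =
     topology_generated_by {{y \<in> V. p (y - x) < e} | p x e. p \<in> P \<and> x \<in> V \<and> 0 < e}"

definition cauchy_filter_in :: "'a::complex_vector topology \<Rightarrow> 'a filter \<Rightarrow> bool" where
  "cauchy_filter_in T F \<longleftrightarrow>
     F \<noteq> bot \<and> eventually (\<lambda>x. x \<in> topspace T) F \<and>
     (\<forall>U. openin T U \<and> 0 \<in> U \<longrightarrow>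
        (\<exists>V. eventually (\<lambda>x. x \<in> V) F \<and> (\<forall>x\<in>V. \<forall>y\<in>V. x - y \<in> U)))"

text \<open>Completeness for the translation-invariant uniformity, not just sequential completeness.\<close>

definition complete_vector_topology :: "'a::complex_vector topology \<Rightarrow> bool" where
  "complete_vector_topology T \<longleftrightarrow>
     (\<forall>F. cauchy_filter_in T F \<longrightarrow> (\<exists>l. limitin T (\<lambda>x. x) l F))"

definition series_converges_to ::
    "'a::complex_vector topology \<Rightarrow> (nat \<Rightarrow> 'a) \<Rightarrow> 'a \<Rightarrow> bool" where
  "series_converges_to T f s \<longleftrightarrow> limitin T (\<lambda>N. \<Sum>n<N. f n) s sequentially"


section \<open>Pro-C*-algebras\<close>

definition cstar_seminorm :: "'a::star_algebra set \<Rightarrow> ('a \<Rightarrow> real) \<Rightarrow> bool" where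
  "cstar_seminorm B p \<longleftrightarrow>
     (\<forall>a\<in>B. 0 \<le> p a) \<and>
     (\<forall>a\<in>B. \<forall>b\<in>B. p (a + b) \<le> p a + p b) \<and>
     (\<forall>c. \<forall>a\<in>B. p (c *\<^sub>C a) = cmod c * p a) \<and>
     (\<forall>a\<in>B. \<forall>b\<in>B. p (a * b) \<le> p a * p b) \<and>
     (\<forall>a\<in>B. p (star a * a) = (p a)\<^sup>2)"

definition directed_on :: "'a set \<Rightarrow> ('a \<Rightarrow> real) set \<Rightarrow> bool" where
  "directed_on B P \<longleftrightarrow>
     P \<noteq> {} \<and> (\<forall>p\<in>P. \<forall>q\<in>P. \<exists>r\<in>P. \<forall>a\<in>B. p a \<le> r a \<and> q a \<le> r a)"

text \<open>
  A pro-C*-algebra is represented by its topology \<open>A\<close>; the underlying *-algebra is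
  \<open>topspace A\<close>.  Continuity of the algebraic operations and of the involution is automatic
  for a topology given by C*-seminorms.
\<close>

definition pro_cstar_algebra :: "'a::star_algebra topology \<Rightarrow> bool" where
  "pro_cstar_algebra A \<longleftrightarrow>
     star_subalgebra (topspace A) \<and>
     (\<exists>P. directed_on (topspace A) P \<and> (\<forall>p\<in>P. cstar_seminorm (topspace A) p) \<and>
          A = seminorm_topology (topspace A) P) \<and>
     Hausdorff_space A \<and>
     complete_vector_topology A"

text \<open>
  Members of \<open>S(A)\<close> are arbitrary off \<open>topspace A\<close>; they are only ever evaluated on it.
\<close>

definition cont_cstar_seminorms :: "'a::star_algebra topology \<Rightarrow> ('a \<Rightarrow> real) set" where
  "cont_cstar_seminorms A =
     {p. cstar_seminorm (topspace A) p \<and> continuous_map A euclideanreal p}"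

text \<open>
  The order of \<open>A\<close>: positive elements are those of the form \<open>c\<^sup>* c\<close> with \<open>c\<close> in \<open>A\<close>.
\<close>

definition positive_in :: "'a::star_algebra topology \<Rightarrow> 'a \<Rightarrow> bool" where
  "positive_in A a \<longleftrightarrow> (\<exists>c\<in>topspace A. a = star c * c)"

definition le_in :: "'a::star_algebra topology \<Rightarrow> 'a \<Rightarrow> 'a \<Rightarrow> bool" where
  "le_in A a b \<longleftrightarrow> a \<in> topspace A \<and> b \<in> topspace A \<and> positive_in A (b - a)"

definition bounded_elements :: "'a::star_algebra topology \<Rightarrow> 'a set" where
  "bounded_elements A =
     {a \<in> topspace A. bdd_above ((\<lambda>p. p a) ` cont_cstar_seminorms A)}"

definition sup_norm :: "'a::star_algebra topology \<Rightarrow> 'a \<Rightarrow> real" where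
  "sup_norm A a = (SUP p\<in>cont_cstar_seminorms A. p a)"

text \<open>
  \<open>b(A)\<close> carries the topology of the norm \<open>\<parallel>\<cdot>\<parallel>\<^sub>\<infinity>\<close>, in general strictly finer than the one induced
  from \<open>A\<close>.
\<close>

definition bounded_part :: "'a::star_algebra topology \<Rightarrow> 'a topology" where
  "bounded_part A = seminorm_topology (bounded_elements A) {sup_norm A}"


section \<open>Hilbert modules\<close>

record ('a, 'e) module_data =
  mcarrier :: "'e set"
  act :: "'e \<Rightarrow> 'a \<Rightarrow> 'e"
  ip :: "'e \<Rightarrow> 'e \<Rightarrow> 'a"

definition pre_hilbert_module ::
    "'a::star_algebra topology \<Rightarrow> ('a, 'e::complex_vector) module_data \<Rightarrow> bool" where
  "pre_hilbert_module A E \<longleftrightarrow>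
     complex_subspace (mcarrier E) \<and>
     (\<forall>x\<in>mcarrier E. \<forall>a\<in>topspace A. act E x a \<in> mcarrier E) \<and>
     (\<forall>x\<in>mcarrier E. \<forall>y\<in>mcarrier E. \<forall>a\<in>topspace A.
        act E (x + y) a = act E x a + act E y a) \<and>
     (\<forall>x\<in>mcarrier E. \<forall>a\<in>topspace A. \<forall>b\<in>topspace A.
        act E x (a + b) = act E x a + act E x b \<and>
        act E x (a * b) = act E (act E x a) b) \<and>
     (\<forall>c. \<forall>x\<in>mcarrier E. \<forall>a\<in>topspace A.
        act E (c *\<^sub>C x) a = c *\<^sub>C act E x a \<and> act E x (c *\<^sub>C a) = c *\<^sub>C act E x a) \<and>
     (\<forall>x\<in>mcarrier E. \<forall>y\<in>mcarrier E. ip E x y \<in> topspace A) \<and>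
     (\<forall>x\<in>mcarrier E. \<forall>y\<in>mcarrier E. \<forall>z\<in>mcarrier E.
        ip E x (y + z) = ip E x y + ip E x z) \<and>
     (\<forall>c. \<forall>x\<in>mcarrier E. \<forall>y\<in>mcarrier E. ip E x (c *\<^sub>C y) = c *\<^sub>C ip E x y) \<and>
     (\<forall>x\<in>mcarrier E. \<forall>y\<in>mcarrier E. \<forall>a\<in>topspace A.
        ip E x (act E y a) = ip E x y * a) \<and>
     (\<forall>x\<in>mcarrier E. \<forall>y\<in>mcarrier E. star (ip E x y) = ip E y x) \<and>
     (\<forall>x\<in>mcarrier E. positive_in A (ip E x x)) \<and>
     (\<forall>x\<in>mcarrier E. ip E x x = 0 \<longleftrightarrow> x = 0)"

definition module_seminorm ::
    "('a, 'e) module_data \<Rightarrow> ('a \<Rightarrow> real) \<Rightarrow> 'e \<Rightarrow> real" where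
  "module_seminorm E p x = sqrt (p (ip E x x))"

definition module_topology ::
    "'a::star_algebra topology \<Rightarrow> ('a, 'e::complex_vector) module_data \<Rightarrow> 'e topology" where
  "module_topology A E =
     seminorm_topology (mcarrier E) (module_seminorm E ` cont_cstar_seminorms A)"

definition hilbert_module ::
    "'a::star_algebra topology \<Rightarrow> ('a, 'e::complex_vector) module_data \<Rightarrow> bool" where
  "hilbert_module A E \<longleftrightarrow>
     pre_hilbert_module A E \<and> complete_vector_topology (module_topology A E)"

definition self_module :: "'a::star_algebra topology \<Rightarrow> ('a, 'a) module_data" where
  "self_module A = \<lparr>mcarrier = topspace A, act = (\<lambda>a b. a * b), ip = (\<lambda>a b. star a * b)\<rparr>"

text \<open>\<open>b(E)\<close>, to be regarded as a module over \<^term>\<open>bounded_part A\<close>.\<close>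

definition bounded_submodule ::
    "'a::star_algebra topology \<Rightarrow> ('a, 'e::complex_vector) module_data
      \<Rightarrow> ('a, 'e) module_data" where
  "bounded_submodule A E =
     E\<lparr>mcarrier :=
         {x \<in> mcarrier E. bdd_above ((\<lambda>p. module_seminorm E p x) ` cont_cstar_seminorms A)}\<rparr>"


section \<open>Adjointable morphisms and multipliers\<close>

text \<open>
  Maps between carriers are taken extensional (\<open>undefined\<close> off the carrier), so that equality
  of functions is equality of morphisms and the adjoint is unique.
\<close>

definition module_morphism ::
    "'a::star_algebra topology \<Rightarrow> ('a, 'e::complex_vector) module_data
      \<Rightarrow> ('a, 'f::complex_vector) module_data \<Rightarrow> ('e \<Rightarrow> 'f) \<Rightarrow> bool" where
  "module_morphism A E F T \<longleftrightarrow>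
     T \<in> mcarrier E \<rightarrow>\<^sub>E mcarrier F \<and>
     (\<forall>x\<in>mcarrier E. \<forall>y\<in>mcarrier E. T (x + y) = T x + T y) \<and>
     (\<forall>c. \<forall>x\<in>mcarrier E. T (c *\<^sub>C x) = c *\<^sub>C T x) \<and>
     (\<forall>x\<in>mcarrier E. \<forall>a\<in>topspace A. T (act E x a) = act F (T x) a)"

definition is_adjoint ::
    "'a::star_algebra topology \<Rightarrow> ('a, 'e::complex_vector) module_data
      \<Rightarrow> ('a, 'f::complex_vector) module_data \<Rightarrow> ('e \<Rightarrow> 'f) \<Rightarrow> ('f \<Rightarrow> 'e) \<Rightarrow> bool" where
  "is_adjoint A E F T S \<longleftrightarrow>
     module_morphism A F E S \<and>
     (\<forall>x\<in>mcarrier E. \<forall>y\<in>mcarrier F. ip F (T x) y = ip E x (S y))"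

definition adjointable ::
    "'a::star_algebra topology \<Rightarrow> ('a, 'e::complex_vector) module_data
      \<Rightarrow> ('a, 'f::complex_vector) module_data \<Rightarrow> ('e \<Rightarrow> 'f) set" where
  "adjointable A E F = {T. module_morphism A E F T \<and> (\<exists>S. is_adjoint A E F T S)}"

definition module_adjoint ::
    "'a::star_algebra topology \<Rightarrow> ('a, 'e::complex_vector) module_data
      \<Rightarrow> ('a, 'f::complex_vector) module_data \<Rightarrow> ('e \<Rightarrow> 'f) \<Rightarrow> ('f \<Rightarrow> 'e)" where
  "module_adjoint A E F T = (THE S. is_adjoint A E F T S)"

definition multipliers ::
    "'a::star_algebra topology \<Rightarrow> ('a, 'e::complex_vector) module_data
      \<Rightarrow> ('a \<Rightarrow> 'e) set" where
  "multipliers A E = adjointable A (self_module A) E"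

text \<open>\<open>\<langle>h, \<xi>\<rangle>\<close> in \<open>M(E)\<close> for \<open>h \<in> M(E)\<close> and \<open>\<xi> \<in> E\<close>; it is the element \<open>h\<^sup>*(\<xi>)\<close> of \<open>A\<close>, and
  \<open>\<langle>\<xi>, h\<rangle>\<close> is its adjoint.\<close>

definition multiplier_ip ::
    "'a::star_algebra topology \<Rightarrow> ('a, 'e::complex_vector) module_data
      \<Rightarrow> ('a \<Rightarrow> 'e) \<Rightarrow> 'e \<Rightarrow> 'a" where
  "multiplier_ip A E h x = module_adjoint A (self_module A) E h x"

definition standard_frame_of_multipliers ::
    "'a::star_algebra topology \<Rightarrow> ('a, 'e::complex_vector) module_data
      \<Rightarrow> (nat \<Rightarrow> 'a \<Rightarrow> 'e) \<Rightarrow> bool" where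
  "standard_frame_of_multipliers A E h \<longleftrightarrow>
     (\<forall>n. h n \<in> multipliers A E) \<and>
     (\<forall>x\<in>mcarrier E. \<exists>s. series_converges_to A
        (\<lambda>n. star (multiplier_ip A E (h n) x) * multiplier_ip A E (h n) x) s) \<and>
     (\<exists>C D :: real. 0 < C \<and> 0 < D \<and>
        (\<forall>x\<in>mcarrier E. \<forall>s. series_converges_to A
            (\<lambda>n. star (multiplier_ip A E (h n) x) * multiplier_ip A E (h n) x) s \<longrightarrow>
          le_in A (complex_of_real C *\<^sub>C ip E x x) s \<and>
          le_in A s (complex_of_real D *\<^sub>C ip E x x)))"

end

theory Submission
  imports Defs
begin

text \<open>
  Every \<open>\<xi>\<close> in \<open>E\<close> factors as \<open>\<xi> = \<eta> (1 + ix)\<close> with \<open>x = \<langle>\<xi>, \<xi>\<rangle>\<close> and \<open>\<eta> = \<xi> (1 + ix)\<^sup>-\<^sup>1\<close> in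
  \<open>b(E)\<close>; the inverse exists in the unitization of \<open>A\<close> because \<open>x\<close> is self-adjoint, and it is bounded
  by \<open>1\<close> for every C*-seminorm. In particular \<open>b(E)\<close> separates the points of \<open>E\<close>, so an adjointable
  map over \<open>b(A)\<close> extends to \<open>E\<close> by \<open>h\<^sup>*(\<xi>) = h\<^sup>*(\<eta>) (1 + ix)\<close>, which is well defined and linear by
  uniqueness. The frame series at \<open>\<xi>\<close> is then the one at \<open>\<eta>\<close> multiplied by \<open>(1 + ix)\<^sup>*\<close> on the left and
  \<open>1 + ix\<close> on the right, an operation which is continuous and preserves the order.
\<close>

section \<open>Elementary algebra\<close>

lemma scaleC_module: "module (scaleC :: complex \<Rightarrow> 'a::complex_vector \<Rightarrow> 'a)"
  by unfold_locales (simp_all add: scaleC_add_right scaleC_add_left scaleC_scaleC scaleC_one)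

lemmas scaleC_zero_left = module.scale_zero_left[OF scaleC_module]
  and scaleC_zero_right = module.scale_zero_right[OF scaleC_module]
  and scaleC_minus_left = module.scale_minus_left[OF scaleC_module]
  and scaleC_minus_right = module.scale_minus_right[OF scaleC_module]
  and scaleC_diff_right = module.scale_right_diff_distrib[OF scaleC_module]

lemma uminus_scaleC: "- x = (-1) *\<^sub>C (x::'a::complex_vector)"
  by (simp add: scaleC_minus_left scaleC_one)

lemma star_minus: "star (- a) = - star (a::'a::star_algebra)"
  by (simp add: uminus_scaleC star_scaleC)

lemma star_diff: "star (a - b) = star a - star (b::'a::star_algebra)"
  using star_add[of a "- b"] by (simp add: star_minus)

lemma star_zero: "star (0::'a::star_algebra) = 0"
  using star_diff[of 0 0] by simp

lemmas star_simps = star_add star_diff star_minus star_zero star_mult star_scaleC star_star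

lemmas scaleC_simps = scaleC_add_right scaleC_diff_right scaleC_minus_right scaleC_minus_left
  scaleC_scaleC scaleC_one scaleC_zero_left scaleC_zero_right scaleC_mult_left scaleC_mult_right

lemma complex_subspace_closed:
  assumes "complex_subspace V"
  shows "0 \<in> V"
    and "x \<in> V \<Longrightarrow> y \<in> V \<Longrightarrow> x + y \<in> V"
    and "x \<in> V \<Longrightarrow> c *\<^sub>C x \<in> V"
    and "x \<in> V \<Longrightarrow> - x \<in> V"
    and "x \<in> V \<Longrightarrow> y \<in> V \<Longrightarrow> x - y \<in> V"
proof -
  show z: "0 \<in> V" and add: "\<And>x y. x \<in> V \<Longrightarrow> y \<in> V \<Longrightarrow> x + y \<in> V"
    and sc: "\<And>c x. x \<in> V \<Longrightarrow> c *\<^sub>C x \<in> V"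
    using assms by (auto simp: complex_subspace_def)
  show m: "- x \<in> V" if "x \<in> V" for x
    using sc[OF that] by (metis uminus_scaleC)
  show "x - y \<in> V" if "x \<in> V" "y \<in> V" for x y
    using add[OF that(1) m[OF that(2)]] by simp
qed

lemma complex_subspace_sum:
  assumes "complex_subspace V" "\<And>i. i \<in> I \<Longrightarrow> f i \<in> V"
  shows "sum f I \<in> V"
  using assms(2) by (induction I rule: infinite_finite_induct)
    (auto intro: complex_subspace_closed[OF assms(1)])

lemma star_subalgebra_closed:
  assumes "star_subalgebra B"
  shows "0 \<in> B"
    and "x \<in> B \<Longrightarrow> y \<in> B \<Longrightarrow> x + y \<in> B"
    and "x \<in> B \<Longrightarrow> c *\<^sub>C x \<in> B"
    and "x \<in> B \<Longrightarrow> - x \<in> B"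
    and "x \<in> B \<Longrightarrow> y \<in> B \<Longrightarrow> x - y \<in> B"
    and "x \<in> B \<Longrightarrow> y \<in> B \<Longrightarrow> x * y \<in> B"
    and "x \<in> B \<Longrightarrow> star x \<in> B"
  using assms complex_subspace_closed[of B] by (auto simp: star_subalgebra_def)


section \<open>C*-seminorms\<close>

lemma cstar_seminormD:
  assumes "cstar_seminorm B p"
  shows "a \<in> B \<Longrightarrow> 0 \<le> p a"
    and "a \<in> B \<Longrightarrow> b \<in> B \<Longrightarrow> p (a + b) \<le> p a + p b"
    and "a \<in> B \<Longrightarrow> p (c *\<^sub>C a) = cmod c * p a"
    and "a \<in> B \<Longrightarrow> b \<in> B \<Longrightarrow> p (a * b) \<le> p a * p b"
    and "a \<in> B \<Longrightarrow> p (star a * a) = (p a)\<^sup>2"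
    and "a \<in> B \<Longrightarrow> p (- a) = p a"
  using assms uminus_scaleC[of a] by (auto simp: cstar_seminorm_def)

context
  fixes B :: "'a::star_algebra set" and p :: "'a \<Rightarrow> real"
  assumes B: "star_subalgebra B" and p: "cstar_seminorm B p"
begin

lemmas B_closed = star_subalgebra_closed[OF B]

lemmas p_simps = cstar_seminormD[OF p]

lemma cstar_seminorm_zero: "p 0 = 0"
  using p_simps(3)[of 0 0] B_closed by (simp add: scaleC_simps)

lemma cstar_seminorm_diff:
  assumes "a \<in> B" "b \<in> B"
  shows "p (a - b) \<le> p a + p b"
  using p_simps(2)[of a "- b"] p_simps(6)[of b] assms B_closed by simp

lemma cstar_seminorm_diff_commute:
  assumes "a \<in> B" "b \<in> B"
  shows "p (a - b) = p (b - a)"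
  using p_simps(6)[of "a - b"] assms B_closed by simp

text \<open>From \<open>(p b)^2 = p (star b * b) \<le> p (star b) * p b\<close> a nonzero
  \<open>p b\<close> cancels; the resulting inequality, used for \<open>a\<close> and for
  \<open>star a\<close>, gives both directions.\<close>

lemma cstar_seminorm_star:
  assumes "a \<in> B"
  shows "p (star a) = p a"
proof -
  have "p b \<le> p (star b)" if b: "b \<in> B" for b
  proof (cases "p b = 0")
    case True
    then show ?thesis using p_simps(1) B_closed b by simp
  next
    case False
    then have "0 < p b" using p_simps(1)[OF b] by simp
    moreover have "p b * p b \<le> p (star b) * p b"
      using p_simps(5)[of b] p_simps(4)[of "star b" b] B_closed b
      by (simp add: power2_eq_square)
    ultimately show ?thesis by simp
  qed
  from this[OF assms] this[of "star a"] show ?thesis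
    using B_closed assms by (simp add: star_simps)
qed

text \<open>
  With \<open>u = t + ix\<close>, the elements \<open>uz\<close> and \<open>u\<^sup>*z\<close> have the same seminorm because \<open>u\<close> is normal, and
  their sum is \<open>2tz\<close>.
\<close>

lemma resolvent_lower_bound:
  assumes x: "x \<in> B" "star x = x" and z: "z \<in> B" and t: "0 \<le> t"
  shows "t * p z \<le> p (complex_of_real t *\<^sub>C z + \<i> *\<^sub>C (x * z))"
proof -
  let ?t = "complex_of_real t"
  let ?u = "?t *\<^sub>C z + \<i> *\<^sub>C (x * z)" and ?v = "?t *\<^sub>C z - \<i> *\<^sub>C (x * z)"
  have mem: "?u \<in> B" "?v \<in> B" using x z B_closed by auto
  have "star ?u * ?u = star ?v * ?v"
    by (simp add: star_simps scaleC_simps x algebra_simps)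
  then have "(p ?u)\<^sup>2 = (p ?v)\<^sup>2"
    using p_simps(5) mem by metis
  then have eq: "p ?u = p ?v"
    using p_simps(1) mem by (simp add: power2_eq_iff_nonneg)
  have "?u + ?v = (2 * ?t) *\<^sub>C z"
    unfolding mult_2[of ?t] scaleC_add_left by simp
  then have "2 * t * p z = p (?u + ?v)"
    using p_simps(3)[OF z] t by (simp add: norm_mult)
  also have "\<dots> \<le> p ?u + p ?v" by (rule p_simps(2)[OF mem])
  finally show ?thesis using eq by simp
qed

text \<open>Iterated correction of the remainder, as in the Neumann series.\<close>

lemma dense_range_of_contraction:
  assumes mem: "\<And>z. z \<in> B \<Longrightarrow> u z \<in> B"
    and add: "\<And>y z. y \<in> B \<Longrightarrow> z \<in> B \<Longrightarrow> u (y + z) = u y + u z"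
    and q: "0 \<le> q" "q < 1"
    and contr: "\<And>w. w \<in> B \<Longrightarrow> \<exists>z\<in>B. p (u z - w) \<le> q * p w"
    and w: "w \<in> B" and e: "0 < e"
  shows "\<exists>z\<in>B. p (u z - w) < e"
proof -
  have iter: "\<exists>z\<in>B. p (u z - w) \<le> q ^ Suc n * p w" for n
  proof (induction n)
    case 0
    then show ?case using contr[OF w] by simp
  next
    case (Suc n)
    then obtain y where y: "y \<in> B" "p (u y - w) \<le> q ^ Suc n * p w" by blast
    define w' where "w' = w - u y"
    have w': "w' \<in> B" using w mem y B_closed by (simp add: w'_def)
    obtain z where z: "z \<in> B" "p (u z - w') \<le> q * p w'" using contr[OF w'] by blast
    have "p w' = p (u y - w)"
      unfolding w'_def using cstar_seminorm_diff_commute w mem y by simp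
    moreover have "u (y + z) - w = u z - w'"
      using add y z by (simp add: w'_def)
    ultimately have "p (u (y + z) - w) \<le> q * p (u y - w)"
      using z by simp
    also have "\<dots> \<le> q * (q ^ Suc n * p w)" using y q by (intro mult_left_mono) auto
    finally show ?case using y z B_closed by (auto simp: mult.assoc)
  qed
  have "(\<lambda>n. q ^ Suc n * p w) \<longlonglongrightarrow> 0 * p w"
    using q by (intro tendsto_mult tendsto_const LIMSEQ_Suc LIMSEQ_power_zero) auto
  then have "eventually (\<lambda>n. q ^ Suc n * p w < e) sequentially"
    using e by (intro order_tendstoD) auto
  then obtain n where "q ^ Suc n * p w < e"
    by (meson eventually_sequentially order_refl)
  then show ?thesis using iter[of n] by force
qed

text \<open>For large \<open>t\<close> the vector \<open>w / t\<close> nearly solves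
  \<open>(t + ix) z = w\<close>, and density of the range survives halving \<open>t\<close> because
  \<open>resolvent_lower_bound\<close> controls approximate solutions. Repeated halving reaches
  \<open>t = 1\<close>. This is the openness of the resolvent set, phrased with approximate
  solutions since \<open>p\<close> alone gives neither completeness nor separation.\<close>

lemma resolvent_dense_range:
  assumes x: "x \<in> B" "star x = x" and w: "w \<in> B" and e: "0 < e"
  shows "\<exists>z\<in>B. p (z + \<i> *\<^sub>C (x * z) - w) < e"
proof -
  define u where "u t z = complex_of_real t *\<^sub>C z + \<i> *\<^sub>C (x * z)" for t z
  have mem: "u t z \<in> B" if "z \<in> B" for t z
    using that x B_closed by (simp add: u_def)
  have add: "u t (y + z) = u t y + u t z" for t y z
    by (simp add: u_def scaleC_simps algebra_simps)
  define dense where "dense t \<longleftrightarrow> (\<forall>w\<in>B. \<forall>e>0. \<exists>z\<in>B. p (u t z - w) < e)" for t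
  have large: "dense t" if t: "p x < t" for t
    unfolding dense_def
  proof (intro ballI allI impI)
    fix w and e :: real
    assume "w \<in> B" "0 < e"
    have t0: "0 < t" using t p_simps(1)[OF x(1)] by simp
    show "\<exists>z\<in>B. p (u t z - w) < e"
    proof (rule dense_range_of_contraction[of "u t" "p x / t"])
      fix v assume v: "v \<in> B"
      \<comment> \<open>With \<open>?z = v / t\<close> the term \<open>t ?z\<close> reproduces
        \<open>v\<close>, so the relative error is at most \<open>p x / t\<close>, below 1 by the
        choice of \<open>t\<close>.\<close>
      let ?z = "complex_of_real (1 / t) *\<^sub>C v"
      have "complex_of_real t * complex_of_real (1 / t) = 1"
        using t0 by (simp flip: of_real_mult)
      then have "u t ?z - v = (\<i> * complex_of_real (1 / t)) *\<^sub>C (x * v)"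
        by (simp add: u_def scaleC_simps)
      then have "p (u t ?z - v) = p (x * v) / t"
        using p_simps(3)[of "x * v"] x v B_closed t0 by (simp add: norm_mult norm_divide)
      also have "\<dots> \<le> p x * p v / t"
        using p_simps(4) x v t0 by (intro divide_right_mono) auto
      finally show "\<exists>z\<in>B. p (u t z - v) \<le> p x / t * p v"
        using B_closed v by (intro bexI[of _ ?z]) auto
    qed (use t t0 p_simps(1)[OF x(1)] \<open>w \<in> B\<close> \<open>0 < e\<close> mem add in auto)
  qed
  have halve: "dense (t / 2)" if d: "dense t" and t: "0 < t" for t
    unfolding dense_def
  proof (intro ballI allI impI)
    fix w and e :: real
    assume "w \<in> B" "0 < e"
    show "\<exists>z\<in>B. p (u (t / 2) z - w) < e"
    \<comment> \<open>The factor is 1/4 + 5/8: an approximate solution \<open>z\<close> for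
      \<open>t\<close> with error below \<open>p v / 4\<close> has
      \<open>t * p z \<le> 5 / 4 * p v\<close>, and passing to \<open>t / 2\<close> changes its
      image by \<open>t / 2\<close> times \<open>z\<close>.\<close>
    proof (rule dense_range_of_contraction[of "u (t / 2)" "7 / 8"])
      fix v assume v: "v \<in> B"
      show "\<exists>z\<in>B. p (u (t / 2) z - v) \<le> 7 / 8 * p v"
      proof (cases "p v = 0")
        case True
        then show ?thesis
          using B_closed p_simps(6)[OF v] by (intro bexI[of _ 0]) (auto simp: u_def scaleC_simps)
      next
        case False
        then have "0 < p v / 4" using p_simps(1)[OF v] by simp
        then obtain z where z: "z \<in> B" "p (u t z - v) < p v / 4"
          using d v unfolding dense_def by blast
        have "p (u t z) \<le> p (u t z - v) + p v"
          using p_simps(2)[of "u t z - v" v] v mem[OF z(1)] B_closed by simp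
        then have "t * p z \<le> 5 / 4 * p v"
          using resolvent_lower_bound[OF x z(1), of t] t z(2) by (simp add: u_def)
        moreover have "u (t / 2) z = u t z - complex_of_real (t / 2) *\<^sub>C z"
        proof -
          have "complex_of_real t *\<^sub>C z
              = complex_of_real (t / 2) *\<^sub>C z + complex_of_real (t / 2) *\<^sub>C z"
            by (simp flip: scaleC_add_left of_real_add)
          then show ?thesis by (simp add: u_def)
        qed
        then have "u (t / 2) z - v = (u t z - v) - complex_of_real (t / 2) *\<^sub>C z" by simp
        with cstar_seminorm_diff[of "u t z - v" "complex_of_real (t / 2) *\<^sub>C z"]
        have "p (u (t / 2) z - v) \<le> p (u t z - v) + p (complex_of_real (t / 2) *\<^sub>C z)"
          using v mem[OF z(1)] z(1) B_closed by metis
        moreover have "p (complex_of_real (t / 2) *\<^sub>C z) = t * p z / 2"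
          using p_simps(3)[OF z(1)] t by simp
        ultimately show ?thesis using z by (intro bexI[of _ z]) auto
      qed
    qed (use \<open>w \<in> B\<close> \<open>0 < e\<close> mem add in auto)
  qed
  \<comment> \<open>Starting from \<open>2 ^ k\<close> above \<open>p x\<close>, exactly
    \<open>k\<close> halvings end at 1.\<close>
  obtain k where k: "p x < 2 ^ k"
    using real_arch_pow[of 2 "p x"] by auto
  have "dense (2 ^ k / 2 ^ n)" for n
  proof (induction n)
    case 0
    show ?case using large[OF k] by simp
  next
    case (Suc n)
    then show ?case using halve[OF Suc] by (simp add: mult.commute)
  qed
  from this[of k] have "dense 1" by simp
  then show ?thesis
    using w e by (auto simp: dense_def u_def scaleC_one)
qed

end


section \<open>Topologies given by seminorms\<close>

lemma openin_seminorm_ball: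
  assumes "p \<in> P" "x \<in> V" "0 < e"
  shows "openin (seminorm_topology V P) {y \<in> V. p (y - x) < e}"
  unfolding seminorm_topology_def
  by (rule topology_generated_by_Basis) (use assms in blast)

lemma topspace_seminorm_topology:
  assumes "p \<in> P" "p 0 = 0"
  shows "topspace (seminorm_topology V P) = V"
proof
  show "topspace (seminorm_topology V P) \<subseteq> V"
    by (auto simp: seminorm_topology_def)
  show "V \<subseteq> topspace (seminorm_topology V P)"
  proof
    fix x assume x: "x \<in> V"
    then have "x \<in> {y \<in> V. p (y - x) < 1}" using assms by simp
    then show "x \<in> topspace (seminorm_topology V P)"
      using openin_subset[OF openin_seminorm_ball[OF assms(1) x, of 1]] by auto
  qed
qed

text \<open>Induction over the way \<open>U\<close> is generated: the subbasic balls have arbitrary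
  centres and are recentred at \<open>l\<close> by the triangle inequality, and directedness
  replaces two seminorms by one for intersections.\<close>

lemma seminorm_ball_in_open:
  assumes B: "star_subalgebra B"
    and P: "directed_on B P" "\<And>p. p \<in> P \<Longrightarrow> cstar_seminorm B p"
    and U: "openin (seminorm_topology B P) U" "l \<in> U"
  shows "\<exists>p\<in>P. \<exists>e>0. {y \<in> B. p (y - l) < e} \<subseteq> U"
proof -
  have lB: "l \<in> B"
    using openin_subset[OF U(1)] U(2) by (auto simp: seminorm_topology_def)
  let ?S = "{{y \<in> B. p (y - x) < e} | p x e. p \<in> P \<and> x \<in> B \<and> 0 < e}"
  have "generate_topology_on ?S U"
    using U(1) by (simp add: seminorm_topology_def openin_topology_generated_by)
  then show ?thesis using U(2)
  proof (induction rule: generate_topology_on.induct)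
    case Empty
    then show ?case by simp
  next
    case (Int a b)
    obtain p e where p: "p \<in> P" "0 < e" "{y \<in> B. p (y - l) < e} \<subseteq> a"
      using Int.IH(1) Int.prems by blast
    obtain q d where q: "q \<in> P" "0 < d" "{y \<in> B. q (y - l) < d} \<subseteq> b"
      using Int.IH(2) Int.prems by blast
    obtain r where r: "r \<in> P" "\<And>a. a \<in> B \<Longrightarrow> p a \<le> r a \<and> q a \<le> r a"
      using P(1) p(1) q(1) unfolding directed_on_def by blast
    have "y - l \<in> B" if "y \<in> B" for y
      using that lB star_subalgebra_closed[OF B] by blast
    then have "{y \<in> B. r (y - l) < min e d}
        \<subseteq> {y \<in> B. p (y - l) < e} \<inter> {y \<in> B. q (y - l) < d}"
      using r(2) by fastforce
    then have "{y \<in> B. r (y - l) < min e d} \<subseteq> a \<inter> b"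
      using p(3) q(3) by blast
    moreover have "0 < min e d" using p q by simp
    ultimately show ?case using r(1) by blast
  next
    case (UN K)
    then obtain k where "k \<in> K" "l \<in> k" by blast
    then obtain p e where "p \<in> P" "0 < e" "{y \<in> B. p (y - l) < e} \<subseteq> k"
      using UN by blast
    then show ?case using \<open>k \<in> K\<close> by blast
  next
    case (Basis s)
    then obtain p x e where p: "p \<in> P" "x \<in> B" "0 < e" "s = {y \<in> B. p (y - x) < e}" by blast
    have d: "p (l - x) < e" using Basis p by simp
    have "p (y - x) < e" if y: "y \<in> B" "p (y - l) < e - p (l - x)" for y
    proof -
      have "p (y - x) \<le> p (y - l) + p (l - x)"
        using cstar_seminormD(2)[OF P(2)[OF p(1)], of "y - l" "l - x"] y(1) lB p(2)
          star_subalgebra_closed[OF B] by simp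
      then show ?thesis using y by simp
    qed
    then have "{y \<in> B. p (y - l) < e - p (l - x)} \<subseteq> s" using p by auto
    then show ?case using d p(1) by (metis diff_gt_0_iff_gt)
  qed
qed

lemma limitin_seminorm_topology:
  assumes B: "star_subalgebra B"
    and P: "directed_on B P" "\<And>p. p \<in> P \<Longrightarrow> cstar_seminorm B p"
    and l: "l \<in> B" and f: "\<And>n. f n \<in> B"
    and lim: "\<And>p e. p \<in> P \<Longrightarrow> 0 < e \<Longrightarrow> eventually (\<lambda>n. p (f n - l) < e) F"
  shows "limitin (seminorm_topology B P) f l F"
proof -
  obtain p where p: "p \<in> P" using P(1) by (auto simp: directed_on_def)
  have "topspace (seminorm_topology B P) = B"
    using topspace_seminorm_topology[of p P B] p cstar_seminorm_zero[OF B P(2)[OF p]] by simp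
  moreover have "eventually (\<lambda>n. f n \<in> U) F"
    if "openin (seminorm_topology B P) U" "l \<in> U" for U
  proof -
    from seminorm_ball_in_open[OF B P that] obtain p e
      where pe: "p \<in> P" "0 < e" "{y \<in> B. p (y - l) < e} \<subseteq> U" by blast
    show ?thesis
      using lim[OF pe(1,2)] by (rule eventually_mono) (use pe(3) f in auto)
  qed
  ultimately show ?thesis using l by (auto simp: limitin_def)
qed


section \<open>The bounded part\<close>

text \<open>A defining family \<open>P\<close> is fixed here, since \<open>pro_cstar_algebra\<close>
  only asserts that one exists. Neighbourhoods are tested with \<open>P\<close>, while boundedness
  refers to all of \<open>cont_cstar_seminorms A\<close>.\<close>

locale pro_cstar =
  fixes A :: "'a::star_algebra topology" and P :: "('a \<Rightarrow> real) set"
  assumes subalgebra: "star_subalgebra (topspace A)"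
    and directed: "directed_on (topspace A) P"
    and cstar: "\<And>p. p \<in> P \<Longrightarrow> cstar_seminorm (topspace A) p"
    and topology: "A = seminorm_topology (topspace A) P"
    and hausdorff: "Hausdorff_space A"
    and complete: "complete_vector_topology A"
begin

lemmas closed = star_subalgebra_closed[OF subalgebra]

lemma ball_in_open:
  "openin A U \<Longrightarrow> l \<in> U \<Longrightarrow> \<exists>p\<in>P. \<exists>e>0. {y \<in> topspace A. p (y - l) < e} \<subseteq> U"
  using seminorm_ball_in_open[OF subalgebra directed cstar] topology by metis

lemma openin_ball:
  "p \<in> P \<Longrightarrow> x \<in> topspace A \<Longrightarrow> 0 < e \<Longrightarrow> openin A {y \<in> topspace A. p (y - x) < e}"
  using openin_seminorm_ball topology by metis

lemma limitin_A:
  assumes "l \<in> topspace A" "\<And>n. f n \<in> topspace A"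
    and "\<And>p e. p \<in> P \<Longrightarrow> 0 < e \<Longrightarrow> eventually (\<lambda>n. p (f n - l) < e) F"
  shows "limitin A f l F"
proof -
  have "limitin (seminorm_topology (topspace A) P) f l F"
    by (rule limitin_seminorm_topology) (use assms subalgebra directed cstar in auto)
  then show ?thesis using topology by simp
qed

text \<open>A neighbourhood of 0 contains a ball of some \<open>p\<close> in \<open>P\<close>, hence
  every element on which all of \<open>P\<close> vanishes; Hausdorff separation leaves only
  0.\<close>

lemma separating:
  assumes a: "a \<in> topspace A" "\<And>p. p \<in> P \<Longrightarrow> p a = 0"
  shows "a = 0"
proof (rule ccontr)
  assume "a \<noteq> 0"
  then obtain V where "openin A V" "0 \<in> V" "a \<notin> V"
    using hausdorff a(1) closed(1) unfolding Hausdorff_space_def disjnt_def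
    by (metis disjoint_iff)
  then obtain p e where "p \<in> P" "0 < e" "{y \<in> topspace A. p (y - 0) < e} \<subseteq> V"
    using ball_in_open by blast
  moreover have "a \<in> {y \<in> topspace A. p (y - 0) < e}"
    using a(1) a(2)[OF \<open>p \<in> P\<close>] \<open>0 < e\<close> by simp
  ultimately have "a \<in> V" by blast
  then show False using \<open>a \<notin> V\<close> by simp
qed

text \<open>Reverse triangle inequality. The inclusion lets bounds by \<open>sup_norm A\<close>, a
  supremum over all continuous C*-seminorms, be used for each \<open>p\<close> in
  \<open>P\<close>.\<close>

lemma defining_seminorms_continuous: "P \<subseteq> cont_cstar_seminorms A"
proof
  fix p assume p: "p \<in> P"
  note c = cstar[OF p]
  have "continuous_map A euclideanreal p"
    unfolding continuous_map_atin
  proof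
    fix a assume a: "a \<in> topspace A"
    show "limitin euclideanreal p (p a) (atin A a)"
      unfolding limitin_canonical_iff tendsto_iff
    proof (intro allI impI)
      fix e :: real assume e: "0 < e"
      have "dist (p y) (p a) < e" if y: "y \<in> topspace A" "p (y - a) < e" for y
        using cstar_seminormD(2)[OF c, of "y - a" a] cstar_seminormD(2)[OF c, of "a - y" y]
          cstar_seminorm_diff_commute[OF subalgebra c a y(1)] y a closed
        by (simp add: dist_real_def)
      then show "\<forall>\<^sub>F y in atin A a. dist (p y) (p a) < e"
        unfolding eventually_atin
        using a openin_ball[OF p a e] e cstar_seminorm_zero[OF subalgebra c]
        by (intro disjI2 exI[of _ "{y \<in> topspace A. p (y - a) < e}"]) auto
    qed
  qed
  then show "p \<in> cont_cstar_seminorms A"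
    using c by (simp add: cont_cstar_seminorms_def)
qed

lemma cont_cstar_seminorms_cstar: "p \<in> cont_cstar_seminorms A \<Longrightarrow> cstar_seminorm (topspace A) p"
  by (simp add: cont_cstar_seminorms_def)

lemma seminorm_le_sup_norm:
  assumes "p \<in> cont_cstar_seminorms A" "a \<in> bounded_elements A"
  shows "p a \<le> sup_norm A a"
  using assms unfolding sup_norm_def bounded_elements_def by (auto intro: cSUP_upper)

lemma bounded_elementsI:
  assumes "a \<in> topspace A" "\<And>p. p \<in> cont_cstar_seminorms A \<Longrightarrow> p a \<le> M"
  shows "a \<in> bounded_elements A"
  using assms by (auto simp: bounded_elements_def intro!: bdd_aboveI[of _ M])

lemma bounded_elements_subspace: "complex_subspace (bounded_elements A)"
  unfolding complex_subspace_def
proof (intro conjI ballI allI)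
  show "0 \<in> bounded_elements A"
    using closed(1) cstar_seminorm_zero[OF subalgebra cont_cstar_seminorms_cstar]
    by (intro bounded_elementsI[of _ 0] eq_refl) blast+
next
  fix a b assume a: "a \<in> bounded_elements A" and b: "b \<in> bounded_elements A"
  then have ab: "a \<in> topspace A" "b \<in> topspace A" by (auto simp: bounded_elements_def)
  show "a + b \<in> bounded_elements A"
  proof (rule bounded_elementsI[of _ "sup_norm A a + sup_norm A b"])
    fix p assume p: "p \<in> cont_cstar_seminorms A"
    then show "p (a + b) \<le> sup_norm A a + sup_norm A b"
      using cstar_seminormD(2)[OF cont_cstar_seminorms_cstar[OF p] ab]
        seminorm_le_sup_norm[OF p a] seminorm_le_sup_norm[OF p b] by simp
  qed (use ab closed in auto)
next
  fix c a assume a: "a \<in> bounded_elements A"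
  then have a': "a \<in> topspace A" by (auto simp: bounded_elements_def)
  show "c *\<^sub>C a \<in> bounded_elements A"
  proof (rule bounded_elementsI[of _ "cmod c * sup_norm A a"])
    fix p assume p: "p \<in> cont_cstar_seminorms A"
    then show "p (c *\<^sub>C a) \<le> cmod c * sup_norm A a"
      using cstar_seminormD(3)[OF cont_cstar_seminorms_cstar[OF p] a']
        seminorm_le_sup_norm[OF p a] by (simp add: mult_left_mono)
  qed (use a' closed in auto)
qed

lemma sup_norm_zero: "sup_norm A 0 = 0"
proof -
  obtain p where "p \<in> P" using directed by (auto simp: directed_on_def)
  then have "cont_cstar_seminorms A \<noteq> {}" using defining_seminorms_continuous by blast
  moreover have "p 0 = 0" if "p \<in> cont_cstar_seminorms A" for p
    using cstar_seminorm_zero[OF subalgebra cont_cstar_seminorms_cstar[OF that]] .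
  ultimately have "(\<lambda>p. p 0) ` cont_cstar_seminorms A = {0}" by force
  then show ?thesis by (simp add: sup_norm_def)
qed

lemma topspace_bounded_part: "topspace (bounded_part A) = bounded_elements A"
  unfolding bounded_part_def by (rule topspace_seminorm_topology[of "sup_norm A"]) (simp_all add: sup_norm_zero)

text \<open>On \<open>b(A)\<close> every \<open>p\<close> in \<open>P\<close> is dominated by
  \<open>sup_norm A\<close>, so norm convergence there gives convergence for each defining seminorm
  of \<open>A\<close>.\<close>

lemma limitin_bounded_part:
  assumes "limitin (bounded_part A) f l F" "p \<in> P" "0 < e"
  shows "eventually (\<lambda>n. p (f n - l) < e) F"
proof -
  let ?U = "{y \<in> bounded_elements A. sup_norm A (y - l) < e}"
  have l: "l \<in> bounded_elements A"
    using assms(1) topspace_bounded_part by (auto simp: limitin_def)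
  have "openin (bounded_part A) ?U"
    unfolding bounded_part_def using l assms(3) by (intro openin_seminorm_ball) auto
  moreover have "l \<in> ?U" using l assms(3) sup_norm_zero by simp
  ultimately have "eventually (\<lambda>n. f n \<in> ?U) F" using assms(1) unfolding limitin_def by blast
  then show ?thesis
  proof (rule eventually_mono)
    fix n assume n: "f n \<in> ?U"
    then have "f n - l \<in> bounded_elements A"
      using l complex_subspace_closed[OF bounded_elements_subspace] by simp
    then have "p (f n - l) \<le> sup_norm A (f n - l)"
      using seminorm_le_sup_norm assms(2) defining_seminorms_continuous by blast
    then show "p (f n - l) < e" using n by simp
  qed
qed


section \<open>The resolvent of a self-adjoint element\<close>

text \<open>In the unitization \<open>r y = (1 + ix)(1 + y) - 1\<close>. The sets
  \<open>S (p, e)\<close> of approximate zeros are nonempty by density of the range and shrink along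
  \<open>P\<close>, so they generate a filter; the lower bound makes it Cauchy, and its limit is a
  zero because \<open>r\<close> is continuous. A filter is used because the topology need not be
  metrizable.\<close>

lemma resolvent_exists:
  assumes x: "x \<in> topspace A" "star x = x"
  obtains y where "y \<in> topspace A" "y + \<i> *\<^sub>C x + \<i> *\<^sub>C (x * y) = 0"
proof -
  define r where "r y = y + \<i> *\<^sub>C x + \<i> *\<^sub>C (x * y)" for y
  have r_mem: "r y \<in> topspace A" if "y \<in> topspace A" for y
    using that x closed by (simp add: r_def)
  define S :: "('a \<Rightarrow> real) \<times> real \<Rightarrow> 'a set" where "S = (\<lambda>(p, e). {y \<in> topspace A. p (r y) < e})"
  define I where "I = P \<times> {0::real<..}"
  define F where "F = (INF i\<in>I. principal (S i))"
  have ev: "eventually Q F \<longleftrightarrow> (\<exists>i\<in>I. \<forall>y\<in>S i. Q y)" for Q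
    unfolding F_def eventually_principal[symmetric]
  proof (rule eventually_INF_base)
    show "I \<noteq> {}"
      using directed gt_ex[of "0::real"] unfolding I_def directed_on_def by blast
    fix i j assume "i \<in> I" "j \<in> I"
    then obtain p e q d where i: "i = (p, e)" "p \<in> P" "0 < e" and j: "j = (q, d)" "q \<in> P" "0 < d"
      by (auto simp: I_def)
    obtain s where s: "s \<in> P" "\<And>a. a \<in> topspace A \<Longrightarrow> p a \<le> s a \<and> q a \<le> s a"
      using directed i(2) j(2) unfolding directed_on_def by blast
    have "S (s, min e d) \<subseteq> S i \<inter> S j"
    proof
      fix y assume "y \<in> S (s, min e d)"
      then have y: "y \<in> topspace A" "s (r y) < min e d" by (auto simp: S_def)
      then show "y \<in> S i \<inter> S j"
        using s(2)[OF r_mem[OF y(1)]] by (simp add: S_def i j)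
    qed
    moreover have "(s, min e d) \<in> I" using s i j by (simp add: I_def)
    ultimately show "\<exists>k\<in>I. principal (S k) \<le> inf (principal (S i)) (principal (S j))"
      by (intro bexI[of _ "(s, min e d)"]) auto
  qed
  have nonempty: "S i \<noteq> {}" if "i \<in> I" for i
  proof -
    obtain p e where i: "i = (p, e)" "p \<in> P" "0 < e" using \<open>i \<in> I\<close> by (auto simp: I_def)
    \<comment> \<open>Taking \<open>- (\<i> *\<^sub>C x)\<close> as target makes the error exactly
      \<open>r z\<close>.\<close>
    have "\<exists>z\<in>topspace A. p (z + \<i> *\<^sub>C (x * z) - (- (\<i> *\<^sub>C x))) < e"
      by (rule resolvent_dense_range[OF subalgebra cstar[OF i(2)] x _ i(3)]) (use x closed in simp)
    then show ?thesis
      by (simp add: S_def i r_def ac_simps) blast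
  qed
  have nb: "F \<noteq> bot"
    using ev[of "\<lambda>_. False"] nonempty by (auto simp: trivial_limit_def)
  have in_S: "eventually (\<lambda>y. y \<in> S (p, e)) F" if "p \<in> P" "0 < e" for p e
    unfolding ev using that by (intro bexI[of _ "(p, e)"]) (auto simp: I_def)
  have "cauchy_filter_in A F"
    unfolding cauchy_filter_in_def
  proof (intro conjI allI impI nb)
    obtain p where "p \<in> P" using directed by (auto simp: directed_on_def)
    from in_S[OF this, of 1] show "eventually (\<lambda>y. y \<in> topspace A) F"
      by (auto simp: S_def elim: eventually_mono)
    fix U assume "openin A U \<and> 0 \<in> U"
    then obtain p e where pe: "p \<in> P" "0 < e" "{y \<in> topspace A. p (y - 0) < e} \<subseteq> U"
      using ball_in_open by blast
    have "y - z \<in> U" if "y \<in> S (p, e / 2)" "z \<in> S (p, e / 2)" for y z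
    proof -
      have yz: "y \<in> topspace A" "z \<in> topspace A" "p (r y) < e / 2" "p (r z) < e / 2"
        using that by (auto simp: S_def)
      \<comment> \<open>This is \<open>(1 + ix)(y - z)\<close>, so smallness of \<open>r y\<close>
        and \<open>r z\<close> forces smallness of \<open>y - z\<close>.\<close>
      have "r y - r z = (y - z) + \<i> *\<^sub>C (x * (y - z))"
        by (simp add: r_def scaleC_simps algebra_simps)
      then have "p (y - z) \<le> p (r y - r z)"
        using resolvent_lower_bound[OF subalgebra cstar[OF pe(1)] x, of "y - z" 1] yz closed
        by (simp add: scaleC_one)
      also have "\<dots> \<le> p (r y) + p (r z)"
        using cstar_seminorm_diff[OF subalgebra cstar[OF pe(1)]] r_mem yz by simp
      finally show ?thesis using yz pe(3) closed by auto
    qed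
    then show "\<exists>V. eventually (\<lambda>y. y \<in> V) F \<and> (\<forall>y\<in>V. \<forall>z\<in>V. y - z \<in> U)"
      using in_S[OF pe(1), of "e / 2"] pe(2) by (intro exI[of _ "S (p, e / 2)"]) auto
  qed
  then obtain l where l: "limitin A (\<lambda>y. y) l F"
    using complete by (auto simp: complete_vector_topology_def)
  then have lA: "l \<in> topspace A" by (simp add: limitin_def)
  have "r l = 0"
  proof (rule separating[OF r_mem[OF lA]])
    fix p assume p: "p \<in> P"
    note c = cstar[OF p]
    \<comment> \<open>Comparison of \<open>l\<close> with a nearby approximate zero
      \<open>y\<close>: one \<open>e\<close> for \<open>r y\<close>, one for \<open>y - l\<close>,
      and \<open>p x * e\<close> for \<open>x * (y - l)\<close>.\<close>
    have bound: "p (r l) \<le> (2 + p x) * e" if e: "0 < e" for e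
    proof -
      have "eventually (\<lambda>y. y \<in> {y \<in> topspace A. p (y - l) < e}) F"
        using l openin_ball[OF p lA e] lA e cstar_seminorm_zero[OF subalgebra c]
        unfolding limitin_def by auto
      then have "eventually (\<lambda>y. y \<in> topspace A \<and> p (y - l) < e \<and> p (r y) < e) F"
        using in_S[OF p e] by eventually_elim (auto simp: S_def)
      then obtain y where y: "y \<in> topspace A" "p (y - l) < e" "p (r y) < e"
        using eventually_happens'[OF nb] by blast
      have d: "y - l \<in> topspace A" using y lA closed by simp
      have "r l = r y - ((y - l) + \<i> *\<^sub>C (x * (y - l)))"
        by (simp add: r_def scaleC_simps algebra_simps)
      then have "p (r l) \<le> p (r y) + p ((y - l) + \<i> *\<^sub>C (x * (y - l)))"
        using cstar_seminorm_diff[OF subalgebra c] r_mem[OF y(1)] d x closed by simp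
      also have "p ((y - l) + \<i> *\<^sub>C (x * (y - l))) \<le> p (y - l) + p (\<i> *\<^sub>C (x * (y - l)))"
        using cstar_seminormD(2)[OF c] d x closed by simp
      also have "p (\<i> *\<^sub>C (x * (y - l))) \<le> p x * p (y - l)"
        using cstar_seminormD(3,4)[OF c] d x closed by simp
      also have "p x * p (y - l) \<le> p x * e"
        using y cstar_seminormD(1)[OF c x(1)] by (intro mult_left_mono) auto
      finally show ?thesis using y by (simp add: algebra_simps)
    qed
    have "p (r l) \<le> 0"
    proof (rule field_le_epsilon)
      fix e :: real assume "0 < e"
      moreover have "0 < 2 + p x" using cstar_seminormD(1)[OF c x(1)] by simp
      ultimately show "p (r l) \<le> 0 + e"
        using bound[of "e / (2 + p x)"] by simp
    qed
    then show "p (r l) = 0"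
      using cstar_seminormD(1)[OF c r_mem[OF lA]] by simp
  qed
  then show ?thesis using that lA by (simp add: r_def)
qed

text \<open>
  In the unitization, \<open>1 + y\<close> is the two-sided inverse of \<open>1 + ix\<close>. Left multiplication by it is a
  contraction for every continuous C*-seminorm, which applied to \<open>y\<^sup>*\<close> gives the uniform bound.
\<close>

lemma resolvent:
  assumes x: "x \<in> topspace A" "star x = x"
  obtains y where "y \<in> topspace A" "y + \<i> *\<^sub>C x + \<i> *\<^sub>C (x * y) = 0"
    "y + \<i> *\<^sub>C x + \<i> *\<^sub>C (y * x) = 0"
    "\<And>p. p \<in> cont_cstar_seminorms A \<Longrightarrow> p y \<le> 2"
proof -
  obtain y where y: "y \<in> topspace A" and eq: "y + \<i> *\<^sub>C x + \<i> *\<^sub>C (x * y) = 0"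
    using resolvent_exists[OF x] .
  have lower: "p z \<le> p (z + \<i> *\<^sub>C (x * z))"
    if "p \<in> cont_cstar_seminorms A" "z \<in> topspace A" for p z
    using resolvent_lower_bound[OF subalgebra cont_cstar_seminorms_cstar[OF that(1)] x that(2), of 1]
    by (simp add: scaleC_one)
  \<comment> \<open>\<open>?w\<close> is \<open>(1 + y)(1 + ix) - 1\<close>. Since
    \<open>1 + y\<close> is a right inverse, \<open>(1 + ix) ?w = 0\<close>, and the lower bound
    makes left multiplication by \<open>1 + ix\<close> injective.\<close>
  let ?w = "y + \<i> *\<^sub>C x + \<i> *\<^sub>C (y * x)"
  have w: "?w \<in> topspace A" using x y closed by simp
  have "?w + \<i> *\<^sub>C (x * ?w) = (y + \<i> *\<^sub>C x + \<i> *\<^sub>C (x * y))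
      + \<i> *\<^sub>C ((y + \<i> *\<^sub>C x + \<i> *\<^sub>C (x * y)) * x)"
    by (simp add: scaleC_simps algebra_simps)
  then have w0: "?w + \<i> *\<^sub>C (x * ?w) = 0"
    by (simp add: eq scaleC_simps)
  have "?w = 0"
  proof (rule separating[OF w])
    fix p assume p: "p \<in> P"
    then have "p ?w \<le> p 0"
      using lower[OF _ w] defining_seminorms_continuous w0 by (metis subsetD)
    then show "p ?w = 0"
      using cstar_seminormD(1)[OF cstar[OF p] w] cstar_seminorm_zero[OF subalgebra cstar[OF p]]
      by simp
  qed
  moreover have "p y \<le> 2" if p: "p \<in> cont_cstar_seminorms A" for p
  proof -
    note c = cont_cstar_seminorms_cstar[OF p]
    let ?z = "star y"
    have z: "?z \<in> topspace A" using y closed by simp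
    \<comment> \<open>The left side is \<open>(1 + ix)(1 + y)\<close> applied to \<open>?z\<close>,
      so \<open>p (?z + y * ?z) \<le> p ?z\<close>. The C*-identity then turns
      \<open>p (y * ?z) \<le> 2 * p ?z\<close> into \<open>p y \<le> 2\<close>.\<close>
    have "(?z + y * ?z) + \<i> *\<^sub>C (x * (?z + y * ?z))
        = ?z + (y + \<i> *\<^sub>C x + \<i> *\<^sub>C (x * y)) * ?z"
      by (simp add: scaleC_simps algebra_simps)
    then have "(?z + y * ?z) + \<i> *\<^sub>C (x * (?z + y * ?z)) = ?z"
      by (simp add: eq)
    then have "p (?z + y * ?z) \<le> p ?z"
      using lower[OF p, of "?z + y * ?z"] z y closed by metis
    then have "p (y * ?z) \<le> 2 * p ?z"
      using cstar_seminorm_diff[OF subalgebra c, of "?z + y * ?z" ?z] z y closed by simp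
    moreover have "p (y * ?z) = p y * p y"
      using cstar_seminormD(5)[OF c z] cstar_seminorm_star[OF subalgebra c y]
      by (simp add: star_simps power2_eq_square)
    ultimately have "p y * p y \<le> 2 * p y"
      using cstar_seminorm_star[OF subalgebra c y] by simp
    then show ?thesis
      using cstar_seminormD(1)[OF c y] by (cases "p y = 0") auto
  qed
  ultimately show ?thesis using that y eq by blast
qed

end

section \<open>Pre-Hilbert modules\<close>

lemma pre_hilbert_moduleD:
  assumes "pre_hilbert_module A E"
  shows "complex_subspace (mcarrier E)"
    and "x \<in> mcarrier E \<Longrightarrow> a \<in> topspace A \<Longrightarrow> act E x a \<in> mcarrier E"
    and "x \<in> mcarrier E \<Longrightarrow> y \<in> mcarrier E \<Longrightarrow> a \<in> topspace A \<Longrightarrow>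
      act E (x + y) a = act E x a + act E y a"
    and "x \<in> mcarrier E \<Longrightarrow> a \<in> topspace A \<Longrightarrow> b \<in> topspace A \<Longrightarrow>
      act E x (a + b) = act E x a + act E x b"
    and "x \<in> mcarrier E \<Longrightarrow> a \<in> topspace A \<Longrightarrow> b \<in> topspace A \<Longrightarrow>
      act E x (a * b) = act E (act E x a) b"
    and "x \<in> mcarrier E \<Longrightarrow> a \<in> topspace A \<Longrightarrow> act E (c *\<^sub>C x) a = c *\<^sub>C act E x a"
    and "x \<in> mcarrier E \<Longrightarrow> y \<in> mcarrier E \<Longrightarrow> ip E x y \<in> topspace A"
    and "x \<in> mcarrier E \<Longrightarrow> y \<in> mcarrier E \<Longrightarrow> z \<in> mcarrier E \<Longrightarrow>
      ip E x (y + z) = ip E x y + ip E x z"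
    and "x \<in> mcarrier E \<Longrightarrow> y \<in> mcarrier E \<Longrightarrow> ip E x (c *\<^sub>C y) = c *\<^sub>C ip E x y"
    and "x \<in> mcarrier E \<Longrightarrow> y \<in> mcarrier E \<Longrightarrow> a \<in> topspace A \<Longrightarrow>
      ip E x (act E y a) = ip E x y * a"
    and "x \<in> mcarrier E \<Longrightarrow> y \<in> mcarrier E \<Longrightarrow> star (ip E x y) = ip E y x"
    and "x \<in> mcarrier E \<Longrightarrow> ip E x x = 0 \<longleftrightarrow> x = 0"
proof -
  note d0 = assms[unfolded pre_hilbert_module_def]
  note d1 = conjunct2[OF d0]
  note d2 = conjunct2[OF d1]
  note d3 = conjunct2[OF d2]
  note d4 = conjunct2[OF d3]
  note d5 = conjunct2[OF d4]
  note d6 = conjunct2[OF d5]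
  note d7 = conjunct2[OF d6]
  note d8 = conjunct2[OF d7]
  note d9 = conjunct2[OF d8]
  note d10 = conjunct2[OF d9]
  show "complex_subspace (mcarrier E)" by (rule conjunct1[OF d0])
  show "act E x a \<in> mcarrier E"
    if "x \<in> mcarrier E" "a \<in> topspace A" for x a
    using conjunct1[OF d1] that by blast
  show "act E (x + y) a = act E x a + act E y a"
    if "x \<in> mcarrier E" "y \<in> mcarrier E" "a \<in> topspace A" for x y a
    using conjunct1[OF d2] that by blast
  show "act E x (a + b) = act E x a + act E x b"
    if "x \<in> mcarrier E" "a \<in> topspace A" "b \<in> topspace A" for x a b
    using conjunct1[OF d3] that by blast
  show "act E x (a * b) = act E (act E x a) b"
    if "x \<in> mcarrier E" "a \<in> topspace A" "b \<in> topspace A" for x a b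
    using conjunct1[OF d3] that by blast
  show "act E (c *\<^sub>C x) a = c *\<^sub>C act E x a"
    if "x \<in> mcarrier E" "a \<in> topspace A" for c x a
    using conjunct1[OF d4] that by blast
  show "ip E x y \<in> topspace A"
    if "x \<in> mcarrier E" "y \<in> mcarrier E" for x y
    using conjunct1[OF d5] that by blast
  show "ip E x (y + z) = ip E x y + ip E x z"
    if "x \<in> mcarrier E" "y \<in> mcarrier E" "z \<in> mcarrier E" for x y z
    using conjunct1[OF d6] that by blast
  show "ip E x (c *\<^sub>C y) = c *\<^sub>C ip E x y"
    if "x \<in> mcarrier E" "y \<in> mcarrier E" for c x y
    using conjunct1[OF d7] that by blast
  show "ip E x (act E y a) = ip E x y * a"
    if "x \<in> mcarrier E" "y \<in> mcarrier E" "a \<in> topspace A" for x y a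
    using conjunct1[OF d8] that by blast
  show "star (ip E x y) = ip E y x"
    if "x \<in> mcarrier E" "y \<in> mcarrier E" for x y
    using conjunct1[OF d9] that by blast
  show "ip E x x = 0 \<longleftrightarrow> x = 0"
    if "x \<in> mcarrier E" for x
    using conjunct2[OF d10] that by blast
qed

lemma pre_hilbert_module_left:
  assumes E: "pre_hilbert_module A E"
    and x: "x \<in> mcarrier E" and y: "y \<in> mcarrier E" and z: "z \<in> mcarrier E"
  shows "ip E (x + y) z = ip E x z + ip E y z"
    and "ip E (c *\<^sub>C x) z = cnj c *\<^sub>C ip E x z"
    and "ip E (x - y) z = ip E x z - ip E y z"
    and "a \<in> topspace A \<Longrightarrow> ip E (act E x a) z = star a * ip E x z"
proof -
  note D = pre_hilbert_moduleD[OF E]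
  note cl = complex_subspace_closed[OF D(1)]
  have add: "ip E (u + v) z = ip E u z + ip E v z" if "u \<in> mcarrier E" "v \<in> mcarrier E" for u v
    using D(11)[of z "u + v"] D(8)[of z u v] D(11)[of z u] D(11)[of z v] cl that z
    by (simp add: star_simps)
  show "ip E (x + y) z = ip E x z + ip E y z" using add x y .
  show "ip E (c *\<^sub>C x) z = cnj c *\<^sub>C ip E x z"
    using D(11)[of z "c *\<^sub>C x"] D(9)[of z x c] D(11)[of z x] cl x z
    by (simp add: star_simps)
  show "ip E (x - y) z = ip E x z - ip E y z"
    using add[of "x - y" y] cl x y by simp
  show "ip E (act E x a) z = star a * ip E x z" if "a \<in> topspace A"
    using D(11)[of z "act E x a"] D(10)[of z x a] D(2)[of x a] D(11)[of z x] x z that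
    by (simp add: star_simps)
qed

text \<open>In the unitization, every \<open>x\<close> is \<open>e (1 + w)\<close> with \<open>e\<close> in the subset.\<close>

definition quasi_generating ::
    "'a::star_algebra topology \<Rightarrow> ('a, 'e::complex_vector) module_data \<Rightarrow> 'e set \<Rightarrow> bool" where
  "quasi_generating A E G \<longleftrightarrow>
     G \<subseteq> mcarrier E \<and> (\<forall>x\<in>mcarrier E. \<exists>e\<in>G. \<exists>w\<in>topspace A. x = e + act E e w)"

lemma quasi_generatingE:
  assumes "quasi_generating A E G" "x \<in> mcarrier E"
  obtains e w where "e \<in> G" "e \<in> mcarrier E" "w \<in> topspace A" "x = e + act E e w"
  using assms unfolding quasi_generating_def by blast

lemma ip_quasi_right:
  assumes E: "pre_hilbert_module A E"
    and "x \<in> mcarrier E" "e \<in> mcarrier E" "w \<in> topspace A"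
  shows "ip E x (e + act E e w) = ip E x e + ip E x e * w"
  using assms pre_hilbert_moduleD(2,8,10)[OF E] by simp

lemma ip_quasi_left:
  assumes E: "pre_hilbert_module A E"
    and "x \<in> mcarrier E" "e \<in> mcarrier E" "w \<in> topspace A"
  shows "ip E (e + act E e w) x = ip E e x + star w * ip E e x"
  using assms pre_hilbert_moduleD(2)[OF E] pre_hilbert_module_left[OF E] by simp

text \<open>The difference \<open>z = x - y\<close> itself factors as \<open>e (1 + w)\<close>, so
  \<open>ip E z z\<close> is \<open>ip E z e\<close> times \<open>1 + w\<close> and vanishes with
  it.\<close>

lemma quasi_generating_separates:
  assumes E: "pre_hilbert_module A E" and G: "quasi_generating A E G"
    and x: "x \<in> mcarrier E" and y: "y \<in> mcarrier E"
    and eq: "\<And>e. e \<in> G \<Longrightarrow> ip E x e = ip E y e"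
  shows "x = y"
proof -
  have z: "x - y \<in> mcarrier E"
    using complex_subspace_closed[OF pre_hilbert_moduleD(1)[OF E]] x y by simp
  then obtain e w where e: "e \<in> G" "e \<in> mcarrier E" "w \<in> topspace A"
    and zeq: "x - y = e + act E e w"
    using quasi_generatingE[OF G] by blast
  have "ip E (x - y) e = 0"
    using pre_hilbert_module_left(3)[OF E x y e(2)] eq[OF e(1)] by simp
  then have "ip E (x - y) (x - y) = 0"
    using ip_quasi_right[OF E z e(2,3)] by (simp flip: zeq)
  then show ?thesis using pre_hilbert_moduleD(12)[OF E z] by simp
qed

text \<open>Testing two adjoints against \<open>?d = R x - S x\<close> gives
  \<open>star ?d * ?d = 0\<close>, and extensional maps agreeing on the carrier are equal. The
  hypotheses on \<open>topspace A\<close> are kept weak enough to serve both \<open>A\<close> and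
  \<open>b(A)\<close>.\<close>

lemma module_adjoint_eq:
  assumes S: "is_adjoint A (self_module A) E T S"
    and sub: "complex_subspace (topspace A)"
    and inj: "\<And>a. a \<in> topspace A \<Longrightarrow> star a * a = 0 \<Longrightarrow> a = 0"
  shows "module_adjoint A (self_module A) E T = S"
  unfolding module_adjoint_def
proof (rule the_equality[where P = "is_adjoint A (self_module A) E T", OF S])
  fix R assume R: "is_adjoint A (self_module A) E T R"
  have ext: "S \<in> mcarrier E \<rightarrow>\<^sub>E topspace A" "R \<in> mcarrier E \<rightarrow>\<^sub>E topspace A"
    using S R by (auto simp: is_adjoint_def module_morphism_def self_module_def)
  show "R = S"
  proof (rule PiE_ext[OF ext(2,1)])
    fix x assume x: "x \<in> mcarrier E"
    let ?d = "R x - S x"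
    have d: "?d \<in> topspace A"
      using ext x complex_subspace_closed[OF sub] by (meson PiE_mem)
    have "star ?d * R x = star ?d * S x"
      using S R x d by (simp add: is_adjoint_def self_module_def)
    then have "star ?d * ?d = 0" by (simp add: right_diff_distrib)
    then show "R x = S x" using inj[OF d] by simp
  qed
qed

text \<open>\<open>compress w t\<close> is \<open>(1 + w)\<^sup>* t (1 + w)\<close> computed in the unitization.\<close>

definition compress :: "'a::star_algebra \<Rightarrow> 'a \<Rightarrow> 'a" where
  "compress w t = t + star w * t + t * w + star w * (t * w)"

lemma compress_add: "compress w (s + t) = compress w s + compress w t"
  by (simp add: compress_def algebra_simps)

lemma compress_diff: "compress w (s - t) = compress w s - compress w t"
  by (simp add: compress_def algebra_simps)

lemma compress_sum: "compress w (sum f I) = (\<Sum>i\<in>I. compress w (f i))"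
  by (induction I rule: infinite_finite_induct) (simp_all add: compress_add, simp_all add: compress_def)

lemma compress_scaleC: "compress w (c *\<^sub>C t) = c *\<^sub>C compress w t"
  by (simp add: compress_def scaleC_simps)

text \<open>Both uses of compression rest on this identity: for \<open>a = b\<close> it keeps
  positive elements positive, and it turns the frame terms at \<open>e\<close> into those at
  \<open>e (1 + w)\<close>.\<close>

lemma compress_star_mult: "compress w (star a * b) = star (a + a * w) * (b + b * w)"
  by (simp add: compress_def star_simps algebra_simps)

lemma compress_ip:
  assumes E: "pre_hilbert_module A E" and e: "e \<in> mcarrier E" and w: "w \<in> topspace A"
  shows "ip E (e + act E e w) (e + act E e w) = compress w (ip E e e)"
proof -
  have "e + act E e w \<in> mcarrier E"
    using complex_subspace_closed(2)[OF pre_hilbert_moduleD(1)[OF E]] pre_hilbert_moduleD(2)[OF E] e w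
    by simp
  then show ?thesis
    using ip_quasi_right[OF E _ e w] ip_quasi_left[OF E e e w]
    by (simp add: compress_def algebra_simps)
qed

section \<open>Compression and bounded vectors over a pro-C*-algebra\<close>

context pro_cstar
begin

lemma star_mult_self_eq_zero:
  assumes "a \<in> topspace A" "star a * a = 0"
  shows "a = 0"
proof (rule separating[OF assms(1)])
  fix p assume "p \<in> P"
  from cstar_seminormD(5)[OF cstar[OF this] assms(1)] show "p a = 0"
    using cstar_seminorm_zero[OF subalgebra cstar[OF \<open>p \<in> P\<close>]] assms(2) by simp
qed

lemma pre_hilbert_self_module: "pre_hilbert_module A (self_module A)"
  unfolding pre_hilbert_module_def self_module_def
  using subalgebra closed star_mult_self_eq_zero
  by (auto simp: star_subalgebra_def positive_in_def star_simps scaleC_simps algebra_simps)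

lemma compress_closed: "w \<in> topspace A \<Longrightarrow> t \<in> topspace A \<Longrightarrow> compress w t \<in> topspace A"
  using closed by (simp add: compress_def)

lemma compress_seminorm_le:
  assumes "p \<in> P" and w: "w \<in> topspace A" and t: "t \<in> topspace A"
  shows "p (compress w t) \<le> (1 + p w)\<^sup>2 * p t"
proof -
  note c = cstar[OF assms(1)]
  note D = cstar_seminormD[OF c]
  have sw: "star w \<in> topspace A" "p (star w) = p w"
    using closed w cstar_seminorm_star[OF subalgebra c w] by simp_all
  have tw: "p (t * w) \<le> p t * p w" "p (star w * t) \<le> p w * p t"
    using D(4)[OF t w] D(4)[OF sw(1) t] sw by simp_all
  have "p (star w * (t * w)) \<le> p w * p (t * w)"
    using D(4)[OF sw(1), of "t * w"] sw closed t w by simp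
  also have "\<dots> \<le> p w * (p t * p w)"
    using tw D(1)[OF w] by (intro mult_left_mono) auto
  finally have wtw: "p (star w * (t * w)) \<le> p w * (p t * p w)" .
  have mem: "star w * t \<in> topspace A" "t * w \<in> topspace A" "star w * (t * w) \<in> topspace A"
    using sw t w closed by simp_all
  have "p (compress w t) \<le> p t + p (star w * t) + p (t * w) + p (star w * (t * w))"
    using D(2)[of "t + star w * t + t * w" "star w * (t * w)"] D(2)[of "t + star w * t" "t * w"]
      D(2)[of t "star w * t"] mem t closed by (simp add: compress_def)
  also have "\<dots> \<le> p t + p w * p t + p t * p w + p w * (p t * p w)"
    using tw wtw by linarith
  finally show ?thesis by (simp add: power2_eq_square algebra_simps)
qed

text \<open>The hypothesis is convergence in the norm of \<open>b(A)\<close>, the conclusion only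
  convergence in \<open>A\<close>: \<open>w\<close> may be unbounded, so \<open>compress w\<close>
  can lead out of \<open>b(A)\<close>.\<close>

lemma limitin_compress:
  assumes w: "w \<in> topspace A" and f: "\<And>n. f n \<in> topspace A"
    and lim: "limitin (bounded_part A) f s F"
  shows "limitin A (\<lambda>n. compress w (f n)) (compress w s) F"
proof (rule limitin_A)
  have bA: "a \<in> bounded_elements A \<Longrightarrow> a \<in> topspace A" for a by (simp add: bounded_elements_def)
  have s: "s \<in> topspace A"
    using lim topspace_bounded_part bA by (auto simp: limitin_def)
  show "compress w s \<in> topspace A" "\<And>n. compress w (f n) \<in> topspace A"
    using compress_closed w s f bA by auto
  fix p and e :: real assume p: "p \<in> P" and e: "0 < e"
  have pos: "0 < (1 + p w)\<^sup>2" using cstar_seminormD(1)[OF cstar[OF p] w] by simp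
  have "eventually (\<lambda>n. p (f n - s) < e / (1 + p w)\<^sup>2) F"
    using limitin_bounded_part[OF lim p] pos e by simp
  then show "eventually (\<lambda>n. p (compress w (f n) - compress w s) < e) F"
  proof (rule eventually_mono)
    fix n assume "p (f n - s) < e / (1 + p w)\<^sup>2"
    then have "(1 + p w)\<^sup>2 * p (f n - s) < e"
      using pos by (simp add: pos_less_divide_eq mult.commute)
    then show "p (compress w (f n) - compress w s) < e"
      using compress_seminorm_le[OF p w, of "f n - s"] s f bA closed by (simp add: compress_diff)
  qed
qed

text \<open>A difference \<open>star c * c\<close> becomes \<open>star d * d\<close> with
  \<open>d = c (1 + w)\<close>; this \<open>d\<close> lies in \<open>A\<close>, though possibly no
  longer in \<open>b(A)\<close>.\<close>

lemma le_in_compress: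
  assumes "le_in (bounded_part A) a b" and w: "w \<in> topspace A"
  shows "le_in A (compress w a) (compress w b)"
proof -
  obtain c where ab: "a \<in> topspace A" "b \<in> topspace A"
    and c: "c \<in> topspace A" "b - a = star c * c"
    using assms(1) unfolding le_in_def positive_in_def topspace_bounded_part bounded_elements_def
    by blast
  have "compress w b - compress w a = star (c + c * w) * (c + c * w)"
    by (simp add: compress_star_mult c(2) flip: compress_diff)
  moreover have "c + c * w \<in> topspace A" using c(1) w closed by simp
  ultimately show ?thesis
    using ab w compress_closed unfolding le_in_def positive_in_def by blast
qed

text \<open>
  The factorization is \<open>x = e (1 + ia)\<close> with \<open>a = \<langle>x, x\<rangle>\<close> and \<open>e = x (1 + ia)\<^sup>-\<^sup>1\<close>.
\<close>

lemma bounded_submodule_quasi_generating: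
  assumes E: "pre_hilbert_module A E"
  shows "quasi_generating A E (mcarrier (bounded_submodule A E))"
  unfolding quasi_generating_def
proof (intro conjI ballI)
  show "mcarrier (bounded_submodule A E) \<subseteq> mcarrier E"
    by (auto simp: bounded_submodule_def)
  fix x assume x: "x \<in> mcarrier E"
  note D = pre_hilbert_moduleD[OF E]
  let ?a = "ip E x x"
  have a: "?a \<in> topspace A" "star ?a = ?a" using D(7,11) x by auto
  obtain y where y: "y \<in> topspace A" and right: "y + \<i> *\<^sub>C ?a + \<i> *\<^sub>C (?a * y) = 0"
    and left: "y + \<i> *\<^sub>C ?a + \<i> *\<^sub>C (y * ?a) = 0"
    and bound: "\<And>p. p \<in> cont_cstar_seminorms A \<Longrightarrow> p y \<le> 2"
    using resolvent[OF a] by blast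
  let ?e = "x + act E x y" and ?w = "\<i> *\<^sub>C ?a"
  have e: "?e \<in> mcarrier E"
    using complex_subspace_closed(2)[OF D(1)] D(2) x y by simp
  have w: "?w \<in> topspace A" by (rule closed(3)[OF a(1)])
  have zero: "act E x 0 = 0"
    using D(4)[OF x closed(1) closed(1)] by simp
  have yw: "y * ?w \<in> topspace A" by (rule closed(6)[OF y w])
  \<comment> \<open>Here \<open>?e = x (1 + y)\<close> and \<open>1 + ?w = 1 + ia\<close>, so the
    left-inverse property \<open>(1 + y)(1 + ia) = 1\<close> collapses the product to
    \<open>x\<close>.\<close>
  have "?e + act E ?e ?w = x + (act E x y + (act E x ?w + act E x (y * ?w)))"
    using D(3)[OF x D(2)[OF x y] w] D(5)[OF x y w] by simp
  also have "act E x y + (act E x ?w + act E x (y * ?w)) = act E x (y + (?w + y * ?w))"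
    using D(4)[OF x y, of "?w + y * ?w"] D(4)[OF x w yw] w yw closed by simp
  also have "y + (?w + y * ?w) = 0"
    using left by (simp add: scaleC_simps add.assoc)
  finally have factor: "x = ?e + act E ?e ?w" using zero by simp
  \<comment> \<open>Since \<open>(1 + ia)(1 + y) = 1\<close>, one has \<open>a (1 + y) = iy\<close>;
    hence \<open>ip E ?e ?e = star (1 + y) a (1 + y)\<close> is expressed by the bounded
    \<open>y\<close> alone.\<close>
  have "\<i> *\<^sub>C (y + \<i> *\<^sub>C ?a + \<i> *\<^sub>C (?a * y)) = 0"
    by (simp add: right scaleC_simps)
  then have ay: "?a + ?a * y = \<i> *\<^sub>C y"
    by (simp add: scaleC_simps algebra_simps)
  have "ip E ?e ?e = (?a + ?a * y) + star y * (?a + ?a * y)"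
    using compress_ip[OF E x y] by (simp add: compress_def algebra_simps)
  then have ipe: "ip E ?e ?e = \<i> *\<^sub>C (y + star y * y)"
    by (simp add: ay scaleC_simps)
  \<comment> \<open>With \<open>p y \<le> 2\<close> the value \<open>p (y + star y * y)\<close> is
    at most \<open>2 + 4 = 6\<close>, and \<open>module_seminorm\<close> takes the root.\<close>
  have "module_seminorm E p ?e \<le> sqrt 6" if p: "p \<in> cont_cstar_seminorms A" for p
  proof -
    note c = cstar_seminormD[OF cont_cstar_seminorms_cstar[OF p]]
    have yy: "star y * y \<in> topspace A" "y + star y * y \<in> topspace A"
      using y closed by simp_all
    have "p (ip E ?e ?e) = p (y + star y * y)"
      using c(3)[OF yy(2)] by (simp add: ipe)
    also have "\<dots> \<le> p y + (p y)\<^sup>2"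
      using c(2)[OF y yy(1)] c(5)[OF y] by simp
    also have "\<dots> \<le> 2 + 2\<^sup>2"
      using bound[OF p] c(1)[OF y] by (intro add_mono power_mono) auto
    finally show ?thesis by (simp add: module_seminorm_def)
  qed
  then have "?e \<in> mcarrier (bounded_submodule A E)"
    using e by (auto simp: bounded_submodule_def intro!: bdd_aboveI[of _ "sqrt 6"])
  then show "\<exists>e\<in>mcarrier (bounded_submodule A E). \<exists>w\<in>topspace A. x = e + act E e w"
    using w factor by blast
qed

text \<open>By the C*-identity, \<open>module_seminorm (self_module A) p\<close> is \<open>p\<close>
  itself on \<open>A\<close>. So \<open>b(A)\<close>, the domain of the given multipliers, is the
  quasi-generating subset obtained for the self module.\<close>

lemma bounded_self_module:
  "mcarrier (bounded_submodule A (self_module A)) = bounded_elements A"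
proof -
  have "module_seminorm (self_module A) p a = p a"
    if "a \<in> topspace A" "p \<in> cont_cstar_seminorms A" for a p
    using cstar_seminormD(1,5)[OF cont_cstar_seminorms_cstar[OF that(2)] that(1)]
    by (simp add: module_seminorm_def self_module_def)
  then have "(\<lambda>p. module_seminorm (self_module A) p a) ` cont_cstar_seminorms A
      = (\<lambda>p. p a) ` cont_cstar_seminorms A" if "a \<in> topspace A" for a
    using that by (intro image_cong) auto
  then show ?thesis
    by (auto simp: bounded_submodule_def bounded_elements_def) (auto simp: self_module_def)
qed


section \<open>Extension of adjointable maps\<close>

text \<open>The required value at \<open>x\<close> is the vector \<open>z\<close> with
  \<open>ip E z e = ip F x (S0 e)\<close> for all \<open>e\<close> in \<open>E0\<close>. It exists
  since \<open>T0 f (1 + w)\<close> does this for \<open>x = f (1 + w)\<close>, and it is unique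
  since \<open>E0\<close> separates. The condition depends on \<open>x\<close> only, so the choice
  of factorization is immaterial and the morphism laws are inherited from
  \<open>ip F\<close>.\<close>

lemma weak_extension:
  assumes F: "pre_hilbert_module A F" and E: "pre_hilbert_module A E"
    and F0: "quasi_generating A F F0" and E0: "quasi_generating A E E0"
    and T0_S0: "T0 \<in> F0 \<rightarrow> mcarrier E" "S0 \<in> E0 \<rightarrow> mcarrier F"
    and adj: "\<forall>f\<in>F0. \<forall>e\<in>E0. ip E (T0 f) e = ip F f (S0 e)"
  shows "\<exists>T. module_morphism A F E T \<and>
    (\<forall>x\<in>mcarrier F. \<forall>e\<in>E0. ip E (T x) e = ip F x (S0 e)) \<and>
    (\<forall>f\<in>F0. \<forall>w\<in>topspace A. T (f + act F f w) = T0 f + act E (T0 f) w)"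
proof -
  note DE = pre_hilbert_moduleD[OF E] and DF = pre_hilbert_moduleD[OF F]
  note clE = complex_subspace_closed[OF DE(1)] and clF = complex_subspace_closed[OF DF(1)]
  have T0: "T0 f \<in> mcarrier E" if "f \<in> F0" for f
    using T0_S0(1) that by blast
  have S0: "S0 e \<in> mcarrier F" if "e \<in> E0" for e
    using T0_S0(2) that by blast
  have F0': "f \<in> mcarrier F" if "f \<in> F0" for f
    using F0 that by (auto simp: quasi_generating_def)
  have E0': "e \<in> mcarrier E" if "e \<in> E0" for e
    using E0 that by (auto simp: quasi_generating_def)
  have formula: "ip E (T0 f + act E (T0 f) w) e = ip F (f + act F f w) (S0 e)"
    if "f \<in> F0" "w \<in> topspace A" "e \<in> E0" for f w e
    using ip_quasi_left[OF E E0'[OF that(3)] T0[OF that(1)] that(2)]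
      ip_quasi_left[OF F S0[OF that(3)] F0'[OF that(1)] that(2)] adj that by simp
  have "\<exists>z\<in>mcarrier E. \<forall>e\<in>E0. ip E z e = ip F x (S0 e)" if x: "x \<in> mcarrier F" for x
  proof -
    obtain f w where f: "f \<in> F0" "w \<in> topspace A" "x = f + act F f w"
      using quasi_generatingE[OF F0 x] by blast
    moreover have "T0 f + act E (T0 f) w \<in> mcarrier E"
      using T0 f clE DE(2) by simp
    ultimately show ?thesis using formula by blast
  qed
  then obtain T' where T': "\<And>x. x \<in> mcarrier F \<Longrightarrow> T' x \<in> mcarrier E"
    "\<And>x e. x \<in> mcarrier F \<Longrightarrow> e \<in> E0 \<Longrightarrow> ip E (T' x) e = ip F x (S0 e)"
    by metis
  define T where "T = restrict T' (mcarrier F)"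
  have T: "\<And>x. x \<in> mcarrier F \<Longrightarrow> T x \<in> mcarrier E"
    "\<And>x e. x \<in> mcarrier F \<Longrightarrow> e \<in> E0 \<Longrightarrow> ip E (T x) e = ip F x (S0 e)"
    using T' by (simp_all add: T_def)
  have T_eqI: "T x = z"
    if "x \<in> mcarrier F" "z \<in> mcarrier E" "\<And>e. e \<in> E0 \<Longrightarrow> ip E z e = ip F x (S0 e)" for x z
    using quasi_generating_separates[OF E E0 T(1)[OF that(1)] that(2)] T(2)[OF that(1)] that(3)
    by simp
  have "module_morphism A F E T"
    unfolding module_morphism_def
  proof (intro conjI ballI allI)
    show "T \<in> mcarrier F \<rightarrow>\<^sub>E mcarrier E" using T'(1) by (simp add: T_def)
    show "T (x + y) = T x + T y" if "x \<in> mcarrier F" "y \<in> mcarrier F" for x y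
      using that T S0 E0' clE clF
      by (intro T_eqI) (simp_all add: pre_hilbert_module_left(1)[OF E] pre_hilbert_module_left(1)[OF F])
    show "T (c *\<^sub>C x) = c *\<^sub>C T x" if "x \<in> mcarrier F" for c x
      using that T S0 E0' clE clF
      by (intro T_eqI) (simp_all add: pre_hilbert_module_left(2)[OF E, of _ 0] pre_hilbert_module_left(2)[OF F, of _ 0])
    show "T (act F x a) = act E (T x) a" if "x \<in> mcarrier F" "a \<in> topspace A" for x a
      using that T S0 E0' clE clF DE(2) DF(2)
      by (intro T_eqI) (simp_all add: pre_hilbert_module_left(4)[OF E, of _ 0] pre_hilbert_module_left(4)[OF F, of _ 0])
  qed
  moreover have "T (f + act F f w) = T0 f + act E (T0 f) w" if "f \<in> F0" "w \<in> topspace A" for f w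
    using that formula T0 F0' clE clF DE(2) DF(2) by (intro T_eqI) simp_all
  ultimately show ?thesis using T(2) by blast
qed

text \<open>The relation \<open>adj\<close> becomes its mirror image under \<open>star\<close>, so
  \<open>weak_extension\<close> applies in both directions and yields \<open>T\<close> and
  \<open>S\<close>. Factoring \<open>y\<close> over \<open>E0\<close> upgrades the pairing of
  \<open>T\<close> with \<open>E0\<close> to full adjointness.\<close>

lemma adjoint_extension:
  assumes F: "pre_hilbert_module A F" and E: "pre_hilbert_module A E"
    and F0: "quasi_generating A F F0" and E0: "quasi_generating A E E0"
    and T0_S0: "T0 \<in> F0 \<rightarrow> mcarrier E" "S0 \<in> E0 \<rightarrow> mcarrier F"
    and adj: "\<forall>f\<in>F0. \<forall>e\<in>E0. ip E (T0 f) e = ip F f (S0 e)"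
  obtains T S where "module_morphism A F E T" "is_adjoint A F E T S"
    "\<And>e w. e \<in> E0 \<Longrightarrow> w \<in> topspace A \<Longrightarrow> S (e + act E e w) = S0 e + act F (S0 e) w"
proof -
  have T0: "T0 f \<in> mcarrier E" if "f \<in> F0" for f
    using T0_S0(1) that by blast
  have S0: "S0 e \<in> mcarrier F" if "e \<in> E0" for e
    using T0_S0(2) that by blast
  have F0': "f \<in> mcarrier F" if "f \<in> F0" for f
    using F0 that by (auto simp: quasi_generating_def)
  have E0': "e \<in> mcarrier E" if "e \<in> E0" for e
    using E0 that by (auto simp: quasi_generating_def)
  have "ip F (S0 e) f = ip E e (T0 f)" if "f \<in> F0" "e \<in> E0" for f e
    using pre_hilbert_moduleD(11)[OF F F0' S0] pre_hilbert_moduleD(11)[OF E T0 E0'] adj that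
    by metis
  then have adj': "\<forall>e\<in>E0. \<forall>f\<in>F0. ip F (S0 e) f = ip E e (T0 f)" by blast
  obtain T where T: "module_morphism A F E T"
    and T_ip: "\<And>x e. x \<in> mcarrier F \<Longrightarrow> e \<in> E0 \<Longrightarrow> ip E (T x) e = ip F x (S0 e)"
    using weak_extension[OF F E F0 E0 T0_S0 adj] by blast
  obtain S where S: "module_morphism A E F S"
    and S_eq: "\<And>e w. e \<in> E0 \<Longrightarrow> w \<in> topspace A \<Longrightarrow> S (e + act E e w) = S0 e + act F (S0 e) w"
    using weak_extension[OF E F E0 F0 T0_S0(2,1) adj'] by blast
  have "ip E (T x) y = ip F x (S y)" if x: "x \<in> mcarrier F" and y: "y \<in> mcarrier E" for x y
  proof -
    obtain e w where e: "e \<in> E0" "w \<in> topspace A" "y = e + act E e w"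
      using quasi_generatingE[OF E0 y] by blast
    have "T x \<in> mcarrier E" using T x by (auto simp: module_morphism_def)
    then show ?thesis
      using ip_quasi_right[OF E _ E0'[OF e(1)] e(2), of "T x"]
        ip_quasi_right[OF F x S0[OF e(1)] e(2)] T_ip[OF x e(1)] S_eq[OF e(1,2)] e(3)
      by simp
  qed
  then have "is_adjoint A F E T S" using S by (simp add: is_adjoint_def)
  then show ?thesis by (rule that[OF T _ S_eq])
qed

text \<open>\<open>h\<close> on \<open>b(A)\<close> and its adjoint on \<open>b(E)\<close> are the
  initial pair for \<open>adjoint_extension\<close>. The formula concerns the extended adjoint,
  because the frame series involves a multiplier only through it.\<close>

lemma multiplier_extension:
  assumes E: "pre_hilbert_module A E"
    and h: "h \<in> multipliers (bounded_part A) (bounded_submodule A E)"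
  defines "m \<equiv> multiplier_ip (bounded_part A) (bounded_submodule A E) h"
  obtains H where "H \<in> multipliers A E"
    "\<And>e. e \<in> mcarrier (bounded_submodule A E) \<Longrightarrow> m e \<in> topspace A"
    "\<And>e w. e \<in> mcarrier (bounded_submodule A E) \<Longrightarrow> w \<in> topspace A \<Longrightarrow>
      multiplier_ip A E H (e + act E e w) = m e + m e * w"
proof -
  let ?bA = "bounded_part A" and ?bE = "bounded_submodule A E"
  obtain S where hm: "module_morphism ?bA (self_module ?bA) ?bE h"
    and S: "is_adjoint ?bA (self_module ?bA) ?bE h S"
    using h by (auto simp: multipliers_def adjointable_def)
  have "module_adjoint ?bA (self_module ?bA) ?bE h = S"
    using bounded_elements_subspace star_mult_self_eq_zero
    by (intro module_adjoint_eq[OF S])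
      (auto simp: topspace_bounded_part bounded_elements_def)
  then have m: "m = S" by (simp add: m_def multiplier_ip_def fun_eq_iff)
  have h_mem: "h b \<in> mcarrier E" if "b \<in> bounded_elements A" for b
    using hm that
    by (auto simp: module_morphism_def self_module_def topspace_bounded_part bounded_submodule_def)
  have S_mem: "S e \<in> bounded_elements A" if "e \<in> mcarrier ?bE" for e
    using S that
    by (auto simp: is_adjoint_def module_morphism_def self_module_def topspace_bounded_part)
  have adj: "ip E (h b) e = ip (self_module A) b (S e)"
    if "b \<in> bounded_elements A" "e \<in> mcarrier ?bE" for b e
    using S that by (auto simp: is_adjoint_def self_module_def topspace_bounded_part)
      (auto simp: bounded_submodule_def)
  obtain H T where H: "module_morphism A (self_module A) E H"
    and T: "is_adjoint A (self_module A) E H T"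
    and T_eq: "\<And>e w. e \<in> mcarrier ?bE \<Longrightarrow> w \<in> topspace A \<Longrightarrow>
      T (e + act E e w) = S e + act (self_module A) (S e) w"
  proof (rule adjoint_extension[OF pre_hilbert_self_module E
        bounded_submodule_quasi_generating[OF pre_hilbert_self_module]
        bounded_submodule_quasi_generating[OF E], where ?T0.0 = h and ?S0.0 = S])
    show "S \<in> mcarrier ?bE \<rightarrow> mcarrier (self_module A)"
      using S_mem by (auto simp: self_module_def bounded_elements_def)
  qed (use h_mem adj in \<open>auto simp: bounded_self_module\<close>)
  have "module_adjoint A (self_module A) E H = T"
    using subalgebra star_mult_self_eq_zero
    by (intro module_adjoint_eq[OF T]) (auto simp: star_subalgebra_def)
  then have "multiplier_ip A E H (e + act E e w) = m e + m e * w"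
    if "e \<in> mcarrier ?bE" "w \<in> topspace A" for e w
    using T_eq[OF that] by (simp add: multiplier_ip_def m self_module_def)
  moreover have "m e \<in> topspace A" if "e \<in> mcarrier ?bE" for e
    using S_mem[OF that] by (simp add: m bounded_elements_def)
  moreover have "H \<in> multipliers A E"
    using H T by (auto simp: multipliers_def adjointable_def)
  ultimately show ?thesis using that by blast
qed

text \<open>For \<open>x = e (1 + w)\<close>, each frame term at \<open>x\<close>, and
  \<open>ip E x x\<close> itself, is the compression by \<open>w\<close> of its counterpart at
  \<open>e\<close>. Compression is linear, continuous and monotone, so sums and inequalities carry
  over with the same \<open>C\<close> and \<open>D\<close>.\<close>

lemma standard_frame_extension:
  assumes E: "pre_hilbert_module A E"
    and frame: "standard_frame_of_multipliers (bounded_part A) (bounded_submodule A E) h"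
  shows "\<exists>H. standard_frame_of_multipliers A E H"
proof -
  let ?bA = "bounded_part A" and ?bE = "bounded_submodule A E"
  define m where "m n = multiplier_ip ?bA ?bE (h n)" for n
  have h: "h n \<in> multipliers ?bA ?bE" for n
    using frame by (simp add: standard_frame_of_multipliers_def)
  have sub: "complex_subspace (topspace A)"
    using subalgebra by (simp add: star_subalgebra_def)
  have "\<exists>H. H \<in> multipliers A E \<and> (\<forall>e\<in>mcarrier ?bE. m n e \<in> topspace A \<and>
      (\<forall>w\<in>topspace A. multiplier_ip A E H (e + act E e w) = m n e + m n e * w))" for n
    unfolding m_def by (rule multiplier_extension[OF E h]) blast
  then obtain H where H: "\<And>n. H n \<in> multipliers A E"
    and H_eq: "\<And>n e w. e \<in> mcarrier ?bE \<Longrightarrow> w \<in> topspace A \<Longrightarrow>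
      multiplier_ip A E (H n) (e + act E e w) = m n e + m n e * w"
    and m_mem: "\<And>n e. e \<in> mcarrier ?bE \<Longrightarrow> m n e \<in> topspace A"
    by metis
  have conv: "\<exists>s. series_converges_to ?bA (\<lambda>n. star (m n e) * m n e) s" if "e \<in> mcarrier ?bE" for e
    using frame that by (simp add: standard_frame_of_multipliers_def m_def)
  obtain C D :: real where CD: "0 < C" "0 < D"
    and bounds: "\<And>e s. e \<in> mcarrier ?bE \<Longrightarrow>
        series_converges_to ?bA (\<lambda>n. star (m n e) * m n e) s \<Longrightarrow>
        le_in ?bA (complex_of_real C *\<^sub>C ip E e e) s \<and>
        le_in ?bA s (complex_of_real D *\<^sub>C ip E e e)"
    using frame unfolding standard_frame_of_multipliers_def m_def[symmetric]
    by (auto simp: bounded_submodule_def)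
  have terms_mem: "star (m n e) * m n e \<in> topspace A" if "e \<in> mcarrier ?bE" for n e
    using m_mem[OF that] closed by simp
  let ?term = "\<lambda>x n. star (multiplier_ip A E (H n) x) * multiplier_ip A E (H n) x"
  have transfer: "series_converges_to A (?term (e + act E e w)) (compress w s)"
    if e: "e \<in> mcarrier ?bE" and w: "w \<in> topspace A"
      and s: "series_converges_to ?bA (\<lambda>n. star (m n e) * m n e) s" for e w s
  proof -
    have "limitin A (\<lambda>N. compress w (\<Sum>n<N. star (m n e) * m n e)) (compress w s) sequentially"
      using s unfolding series_converges_to_def
      by (rule limitin_compress[OF w complex_subspace_sum[OF sub terms_mem[OF e]]])
    then show ?thesis
      by (simp add: series_converges_to_def compress_sum compress_star_mult H_eq[OF e w])
  qed
  have frame_at: "\<exists>s. series_converges_to A (?term x) s \<and>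
      le_in A (complex_of_real C *\<^sub>C ip E x x) s \<and> le_in A s (complex_of_real D *\<^sub>C ip E x x)"
    if xE: "x \<in> mcarrier E" for x
  proof -
    obtain e w where e: "e \<in> mcarrier ?bE" "w \<in> topspace A" and x: "x = e + act E e w"
      by (rule quasi_generatingE[OF bounded_submodule_quasi_generating[OF E] xE])
    have eE: "e \<in> mcarrier E" using e by (simp add: bounded_submodule_def)
    obtain s where s: "series_converges_to ?bA (\<lambda>n. star (m n e) * m n e) s"
      using conv[OF e(1)] by blast
    have scale: "compress w (c *\<^sub>C ip E e e) = c *\<^sub>C ip E x x" for c
      by (simp add: compress_scaleC compress_ip[OF E eE e(2)] x)
    have "le_in A (complex_of_real C *\<^sub>C ip E x x) (compress w s)"
      "le_in A (compress w s) (complex_of_real D *\<^sub>C ip E x x)"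
      using bounds[OF e(1) s, THEN conjunct1, THEN le_in_compress, OF e(2)]
        bounds[OF e(1) s, THEN conjunct2, THEN le_in_compress, OF e(2)]
      by (simp_all add: scale)
    moreover have "series_converges_to A (?term x) (compress w s)"
      unfolding x by (rule transfer[OF e s])
    ultimately show ?thesis by blast
  qed
  \<comment> \<open>The frame bounds are demanded of every limit of the series, whereas
    \<open>frame_at\<close> supplies one; Hausdorffness identifies them.\<close>
  have unique: "s = s'"
    if "series_converges_to A f s" "series_converges_to A f s'" for f s s'
    using that limitin_Hausdorff_unique[OF _ _ sequentially_bot hausdorff]
    unfolding series_converges_to_def by blast
  have "standard_frame_of_multipliers A E H"
    unfolding standard_frame_of_multipliers_def
  proof (intro conjI allI ballI H)
    show "\<exists>s. series_converges_to A (?term x) s" if "x \<in> mcarrier E" for x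
      using frame_at[OF that] by blast
    show "\<exists>C D. 0 < C \<and> 0 < D \<and> (\<forall>x\<in>mcarrier E. \<forall>s. series_converges_to A (?term x) s \<longrightarrow>
        le_in A (complex_of_real C *\<^sub>C ip E x x) s \<and> le_in A s (complex_of_real D *\<^sub>C ip E x x))"
    proof (rule exI[of _ C], rule exI[of _ D], intro conjI[OF CD(1)] conjI[OF CD(2)] ballI allI impI)
      fix x s assume "x \<in> mcarrier E" "series_converges_to A (?term x) s"
      with frame_at[of x] show "le_in A (complex_of_real C *\<^sub>C ip E x x) s \<and>
          le_in A s (complex_of_real D *\<^sub>C ip E x x)"
        using unique by blast
    qed
  qed
  then show ?thesis by blast
qed

end

theorem corollary3p13:
  fixes A :: "'a::star_algebra topology"
    and E :: "('a, 'e::complex_vector) module_data"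
  assumes "pro_cstar_algebra A"
    and "hilbert_module A E"
    and "\<exists>h. standard_frame_of_multipliers (bounded_part A) (bounded_submodule A E) h"
  shows "\<exists>h. standard_frame_of_multipliers A E h"
proof -
  obtain P where "pro_cstar A P"
    using assms(1) by (auto simp: pro_cstar_algebra_def pro_cstar_def)
  then show ?thesis
    using pro_cstar.standard_frame_extension assms(2,3) by (auto simp: hilbert_module_def)
qed

end
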